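(* Let $0<p\le 1$, let $\mathscr{U}$ be a countably incomplete ultrafilter on a set $I$, and let $f_i:X_i\to Y_i$ ($i\in I$) be a family of homogeneous mappings acting between $p$-Banach spaces. The following are equivalent: (a) $(f_i)$ is admissible and $(f_i)_{\mathscr{U}}:(X_i)_{\mathscr{U}}\to (Y_i)_{\mathscr{U}}$ is a bounded linear operator. (b) $\lim_{\mathscr{U}(i)}\|f_i\|<\infty$ and $\lim_{\mathscr{U}(i)}Q[f_i]=0$. Moreover, [when these conditions hold] $(f_i)_{\mathscr{U}}$ is an ultraproduct of operators if and only if there is a family $u_i\in L(X_i,Y_i)$ such that $\|f_i-u_i\|\to 0$ along $\mathscr{U}$.
   Context: The ground field is $\mathbb{R}$. A $p$-norm ($0<p\le1$) on a linear space $X$ is a function $\|\cdot\|:X\to[0,\infty)$, vanishing only at $0$, with $\|tx\|=|t|\|x\|$ for $t\in\mathbb{R}$ and $\|x+y\|^p\le\|x\|^p+\|y\|^p$; a $p$-Banach space is a complete $p$-normed space. Limits along $\mathscr{U}$ of $[0,\infty]$-valued functions on $I$ are taken in $[0,\infty]$. For a family $(X_i)_{i\in I}$ of $p$-Banach spaces, the ultraproduct $(X_i)_{\mathscr{U}}$ is the quotient of the space of families $(x_i)\in\prod_i X_i$ with $\lim_{\mathscr{U}(i)}\|x_i\|<\infty$ by the subspace of families with $\lim_{\mathscr{U}(i)}\|x_i\|=0$, with the $p$-norm $\|(x_i)_{\mathscr{U}}\|=\lim_{\mathscr{U}(i)}\|x_i\|$, where $(x_i)_{\mathscr{U}}$ denotes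 the class of $(x_i)$. (Equivalently, bounded families modulo those tending to $0$ in norm along $\mathscr{U}$.) A map $f:X\to Y$ between linear spaces is homogeneous if $f(tx)=tf(x)$ for all $t\in\mathbb{R}$, $x\in X$. For a homogeneous map between quasinormed spaces, $\|f\|=\sup_{\|x\|=1}\|f(x)\|\in[0,\infty]$, and $Q[f]\in[0,\infty]$ is the least constant $Q$ with $\|f(x+y)-f(x)-f(y)\|\le Q(\|x\|+\|y\|)$ for all $x,y\in X$ ($Q[f]=\infty$ if there is none). $L(X,Y)$ is the space of bounded linear maps $X\to Y$. A family of mappings $f_i:X_i\to Y_i$ is admissible if there is a mapping $f:(X_i)_{\mathscr{U}}\to(Y_i)_{\mathscr{U}}$ such that $f((x_i)_{\mathscr{U}})=(f_i(x_i))_{\mathscr{U}}$ for every bounded family $(x_i)$; the map $f$ is then called accessible and denoted $(f_i)_{\mathscr{U}}$. An ultraproduct of operators is a map of the form $(u_i)_{\mathscr{U}}$ with $u_i\in L(X_i,Y_i)$ a uniformly bounded family. *)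

theory Defs
  imports "HOL-Analysis.Analysis" "HOL-Algebra.Module" "HOL-Algebra.AbelCoset"
begin

definition ultrafilter :: "'i filter \<Rightarrow> bool" where
  "ultrafilter U \<longleftrightarrow>
     U \<noteq> bot \<and> (\<forall>P. eventually P U \<or> eventually (\<lambda>i. \<not> P i) U)"

definition countably_incomplete :: "'i filter \<Rightarrow> bool" where
  "countably_incomplete U \<longleftrightarrow>
     (\<exists>A :: nat \<Rightarrow> 'i set. (\<forall>n. eventually (\<lambda>i. i \<in> A n) U)
        \<and> \<not> eventually (\<lambda>i. i \<in> (\<Inter>n. A n)) U)"

text \<open>Limits of \<open>[0,\<infinity>]\<close>-valued functions are limits in \<^typ>\<open>ennreal\<close>; along an ultrafilter
  they always exist and are unique, and the next predicate says that the limit is \<open>< \<infinity>\<close>.\<close>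

definition finite_limit :: "'i filter \<Rightarrow> ('i \<Rightarrow> ennreal) \<Rightarrow> bool" where
  "finite_limit U g \<longleftrightarrow> (\<exists>l. l < \<infinity> \<and> (g \<longlongrightarrow> l) U)"

text \<open>Real linear spaces are modules, in the sense of HOL-Algebra, over the field of reals.
  The fields \<^const>\<open>mult\<close> and \<^const>\<open>one\<close> of the module record are unconstrained for modules
  and play no role.\<close>

definition real_ring :: "real ring" where
  "real_ring = \<lparr>carrier = UNIV, mult = (*), one = 1, zero = 0, add = (+)\<rparr>"

record 'a normed_module = "(real, 'a) module" +
  nrm :: "'a \<Rightarrow> real"

locale p_normed_space = module real_ring X
  for p :: real and X :: "('a, 'b) normed_module_scheme" (structure) +
  assumes p_pos: "0 < p" and p_le_1: "p \<le> 1"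
    and nrm_nonneg: "x \<in> carrier X \<Longrightarrow> 0 \<le> nrm X x"
    and nrm_eq_0_imp: "x \<in> carrier X \<Longrightarrow> nrm X x = 0 \<Longrightarrow> x = \<zero>\<^bsub>X\<^esub>"
    and nrm_smult: "x \<in> carrier X \<Longrightarrow> nrm X (t \<odot>\<^bsub>X\<^esub> x) = \<bar>t\<bar> * nrm X x"
    and nrm_add: "x \<in> carrier X \<Longrightarrow> y \<in> carrier X \<Longrightarrow>
      nrm X (x \<oplus>\<^bsub>X\<^esub> y) powr p \<le> nrm X x powr p + nrm X y powr p"

locale p_banach_space = p_normed_space +
  assumes complete: "\<And>s :: nat \<Rightarrow> 'a. range s \<subseteq> carrier X \<Longrightarrow>
      (\<forall>e>0. \<exists>N. \<forall>m\<ge>N. \<forall>n\<ge>N. nrm X (s m \<ominus>\<^bsub>X\<^esub> s n) < e) \<Longrightarrow>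
      \<exists>l\<in>carrier X. (\<lambda>n. nrm X (s n \<ominus>\<^bsub>X\<^esub> l)) \<longlonglongrightarrow> 0"

definition homogeneous_map ::
  "('a, 'm) normed_module_scheme \<Rightarrow> ('b, 'n) normed_module_scheme \<Rightarrow> ('a \<Rightarrow> 'b) \<Rightarrow> bool" where
  "homogeneous_map X Y f \<longleftrightarrow> f \<in> carrier X \<rightarrow> carrier Y \<and>
     (\<forall>t. \<forall>x\<in>carrier X. f (t \<odot>\<^bsub>X\<^esub> x) = t \<odot>\<^bsub>Y\<^esub> f x)"

definition map_norm ::
  "('a, 'm) normed_module_scheme \<Rightarrow> ('b, 'n) normed_module_scheme \<Rightarrow> ('a \<Rightarrow> 'b) \<Rightarrow> ennreal" where
  "map_norm X Y f = (SUP x\<in>{x \<in> carrier X. nrm X x = 1}. ennreal (nrm Y (f x)))"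

text \<open>The infimum below is attained when the set is nonempty, and it is \<open>\<infinity>\<close> when the set is
  empty.\<close>

definition quasilinearity ::
  "('a, 'm) normed_module_scheme \<Rightarrow> ('b, 'n) normed_module_scheme \<Rightarrow> ('a \<Rightarrow> 'b) \<Rightarrow> ennreal" where
  "quasilinearity X Y f = Inf {ennreal Q | Q. 0 \<le> Q \<and>
     (\<forall>x\<in>carrier X. \<forall>y\<in>carrier X.
        nrm Y (f (x \<oplus>\<^bsub>X\<^esub> y) \<ominus>\<^bsub>Y\<^esub> f x \<ominus>\<^bsub>Y\<^esub> f y) \<le> Q * (nrm X x + nrm X y))}"

definition bounded_operators ::
  "('a, 'm) normed_module_scheme \<Rightarrow> ('b, 'n) normed_module_scheme \<Rightarrow> ('a \<Rightarrow> 'b) set" where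
  "bounded_operators X Y = {u. u \<in> carrier X \<rightarrow> carrier Y \<and>
     (\<forall>x\<in>carrier X. \<forall>y\<in>carrier X. u (x \<oplus>\<^bsub>X\<^esub> y) = u x \<oplus>\<^bsub>Y\<^esub> u y) \<and>
     (\<forall>t. \<forall>x\<in>carrier X. u (t \<odot>\<^bsub>X\<^esub> x) = t \<odot>\<^bsub>Y\<^esub> u x) \<and>
     map_norm X Y u < \<infinity>}"

definition family_space ::
  "'i filter \<Rightarrow> ('i \<Rightarrow> 'a normed_module) \<Rightarrow> (real, 'i \<Rightarrow> 'a) module" where
  "family_space U X =
     \<lparr>carrier = {x. (\<forall>i. x i \<in> carrier (X i)) \<and> finite_limit U (\<lambda>i. ennreal (nrm (X i) (x i)))},
      mult = undefined, one = undefined,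
      zero = (\<lambda>i. \<zero>\<^bsub>X i\<^esub>),
      add = (\<lambda>x y i. x i \<oplus>\<^bsub>X i\<^esub> y i),
      smult = (\<lambda>t x i. t \<odot>\<^bsub>X i\<^esub> x i)\<rparr>"

definition null_families :: "'i filter \<Rightarrow> ('i \<Rightarrow> 'a normed_module) \<Rightarrow> ('i \<Rightarrow> 'a) set" where
  "null_families U X =
     {x \<in> carrier (family_space U X). ((\<lambda>i. nrm (X i) (x i)) \<longlongrightarrow> 0) U}"

definition ultraclass ::
  "'i filter \<Rightarrow> ('i \<Rightarrow> 'a normed_module) \<Rightarrow> ('i \<Rightarrow> 'a) \<Rightarrow> ('i \<Rightarrow> 'a) set" where
  "ultraclass U X x = null_families U X +>\<^bsub>family_space U X\<^esub> x"

text \<open>All members of a coset have the same limit of norms, and for \<open>t \<noteq> 0\<close> the union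
  below is the elementwise multiple, while for \<open>t = 0\<close> it is the zero coset.\<close>

definition ultraproduct ::
  "'i filter \<Rightarrow> ('i \<Rightarrow> 'a normed_module) \<Rightarrow> ('i \<Rightarrow> 'a) set normed_module" where
  "ultraproduct U X =
     \<lparr>carrier = a_rcosets\<^bsub>family_space U X\<^esub> (null_families U X),
      mult = undefined, one = undefined,
      zero = null_families U X,
      add = set_add (family_space U X),
      smult = (\<lambda>t A. \<Union>x\<in>A. ultraclass U X (t \<odot>\<^bsub>family_space U X\<^esub> x)),
      nrm = (\<lambda>A. THE r. \<forall>x\<in>A. ((\<lambda>i. nrm (X i) (x i)) \<longlongrightarrow> r) U)\<rparr>"

definition bounded_family :: "('i \<Rightarrow> 'a normed_module) \<Rightarrow> ('i \<Rightarrow> 'a) \<Rightarrow> bool" where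
  "bounded_family X x \<longleftrightarrow>
     (\<forall>i. x i \<in> carrier (X i)) \<and> (\<exists>B. \<forall>i. nrm (X i) (x i) \<le> B)"

text \<open>The first conjunct in the scope of the quantifier says that \<open>(f\<^sub>i(x\<^sub>i))\<close> does
  represent an element of the ultraproduct of the \<open>Y\<^sub>i\<close>. Maps between ultraproducts
  are extensional functions on the carrier, so that at most one map is induced by a family.\<close>

definition induces ::
  "'i filter \<Rightarrow> ('i \<Rightarrow> 'a normed_module) \<Rightarrow> ('i \<Rightarrow> 'b normed_module) \<Rightarrow> ('i \<Rightarrow> 'a \<Rightarrow> 'b)
    \<Rightarrow> (('i \<Rightarrow> 'a) set \<Rightarrow> ('i \<Rightarrow> 'b) set) \<Rightarrow> bool" where
  "induces U X Y f F \<longleftrightarrow>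
     F \<in> carrier (ultraproduct U X) \<rightarrow>\<^sub>E carrier (ultraproduct U Y) \<and>
     (\<forall>x. bounded_family X x \<longrightarrow>
        (\<lambda>i. f i (x i)) \<in> carrier (family_space U Y) \<and>
        F (ultraclass U X x) = ultraclass U Y (\<lambda>i. f i (x i)))"

definition admissible ::
  "'i filter \<Rightarrow> ('i \<Rightarrow> 'a normed_module) \<Rightarrow> ('i \<Rightarrow> 'b normed_module) \<Rightarrow> ('i \<Rightarrow> 'a \<Rightarrow> 'b) \<Rightarrow> bool" where
  "admissible U X Y f \<longleftrightarrow> (\<exists>F. induces U X Y f F)"

definition accessible_map ::
  "'i filter \<Rightarrow> ('i \<Rightarrow> 'a normed_module) \<Rightarrow> ('i \<Rightarrow> 'b normed_module) \<Rightarrow> ('i \<Rightarrow> 'a \<Rightarrow> 'b)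
    \<Rightarrow> ('i \<Rightarrow> 'a) set \<Rightarrow> ('i \<Rightarrow> 'b) set" where
  "accessible_map U X Y f = (THE F. induces U X Y f F)"

definition ultraproduct_of_operators ::
  "'i filter \<Rightarrow> ('i \<Rightarrow> 'a normed_module) \<Rightarrow> ('i \<Rightarrow> 'b normed_module)
    \<Rightarrow> (('i \<Rightarrow> 'a) set \<Rightarrow> ('i \<Rightarrow> 'b) set) \<Rightarrow> bool" where
  "ultraproduct_of_operators U X Y F \<longleftrightarrow>
     (\<exists>u. (\<forall>i. u i \<in> bounded_operators (X i) (Y i)) \<and>
          (\<exists>C::real. \<forall>i. map_norm (X i) (Y i) (u i) \<le> ennreal C) \<and>
          admissible U X Y u \<and> F = accessible_map U X Y u)"

end

(* Along an ultrafilter every statement about limits becomes one about eventual bounds.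
   If the maps are eventually C-bounded and Q[f_i] tends to 0, then f_i(x_i + y_i) differs from
   f_i(x_i) + f_i(y_i) by a null family; with y_i replaced by a null family this shows that the
   class of (f_i(x_i)) depends only on the class of (x_i), and in general it shows additivity.
   Conversely, homogeneity lets a violation of a bound be witnessed in the unit balls; the
   witnesses form bounded families, at which the induced map would fail to be defined or
   additive.  Countable incompleteness is needed only to diagonalise: bounds violated by every
   constant yield one family with norms of f_i(x_i) tending to infinity.  The last equivalence
   is the same selection argument applied to f_i - u_i. *)

theory Submission
  imports Defs
begin

text \<open>Two mismatches shape the argument. Limits ignore index sets that are negligible for the
  ultrafilter, while \<open>bounded_family\<close> and \<open>ultraproduct_of_operators\<close> ask
  for bounds at every index; the gap is closed by putting the zero vector or the zero operator at
  the bad indices, which changes no class. Also, a p-norm satisfies the triangle inequality only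
  after taking p-th powers: rough estimates use the quasinorm inequality with constant 2 powr (1/p),
  while the exact limit of norms along a class is found through p-th powers. Diagonalisation is
  confined to boundedness because there every constant fails, each on its own large set of indices,
  and one family must defeat them all. Failure of a limit to be 0 is already witnessed by one fixed
  e > 0, violated on a large set because the filter is ultra, so one choice of witnesses suffices
  for the quasilinearity constants and for f_i - u_i.\<close>

lemma carrier_real_ring [simp]: "carrier real_ring = UNIV"
  and one_real_ring [simp]: "\<one>\<^bsub>real_ring\<^esub> = 1"
  and zero_real_ring [simp]: "\<zero>\<^bsub>real_ring\<^esub> = 0"
  and add_real_ring [simp]: "x \<oplus>\<^bsub>real_ring\<^esub> y = x + y"
  by (simp_all add: real_ring_def)

section \<open>Limits along an ultrafilter, and diagonalisation\<close>

lemma ultrafilter_nonevD: "ultrafilter U \<Longrightarrow> \<not> eventually P U \<Longrightarrow> \<forall>\<^sub>F i in U. \<not> P i"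
  by (auto simp: ultrafilter_def)

text \<open>A property of \<open>F\<close> that is not eventual in \<open>U\<close> has its negation
  eventual in \<open>U\<close>, and then the meet of the two filters would be trivial. With
  \<open>F\<close> a neighbourhood filter: cluster points of ultrafilters are limits.\<close>

lemma ultrafilter_le_of_inf:
  assumes "ultrafilter U" "inf F U \<noteq> bot"
  shows "U \<le> F"
proof (rule filter_leI)
  fix P assume P: "eventually P F"
  show "eventually P U"
  proof (rule ccontr)
    assume "\<not> eventually P U"
    then have "\<forall>\<^sub>F i in U. \<not> P i" by (rule ultrafilter_nonevD[OF assms(1)])
    with P have "eventually (\<lambda>_. False) (inf F U)"
      unfolding eventually_inf by blast
    with assms(2) show False by (simp add: trivial_limit_def)
  qed
qed

text \<open>Compactness of \<open>{a..b}\<close> gives the image filter a cluster point; the image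
  of an ultrafilter is again one, so it converges there.\<close>

lemma ultrafilter_tendsto_real:
  fixes g :: "'i \<Rightarrow> real"
  assumes U: "ultrafilter U" and "\<forall>\<^sub>F i in U. a \<le> g i \<and> g i \<le> b"
  obtains l where "(g \<longlongrightarrow> l) U" "a \<le> l" "l \<le> b"
proof -
  have bot: "filtermap g U \<noteq> bot"
    using U by (simp add: ultrafilter_def filtermap_bot_iff)
  have ev: "eventually (\<lambda>x. x \<in> {a..b}) (filtermap g U)"
    using assms(2) by (simp add: eventually_filtermap)
  obtain l where l: "l \<in> {a..b}" "inf (nhds l) (filtermap g U) \<noteq> bot"
    using compact_filter[THEN iffD1, OF compact_Icc, rule_format, OF bot ev] by blast
  have "ultrafilter (filtermap g U)"
    using U bot by (auto simp: ultrafilter_def eventually_filtermap)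
  then have "filtermap g U \<le> nhds l"
    using l(2) by (rule ultrafilter_le_of_inf)
  then show thesis using l that by (simp add: filterlim_def)
qed

text \<open>The existence of the limit comes for free from compactness, so only boundedness is left
  to check. The converse takes the limit among the reals through \<open>enn2real\<close> and
  transports it back.\<close>

lemma finite_limit_iff_ev_bounded:
  fixes g :: "'i \<Rightarrow> ennreal"
  assumes U: "ultrafilter U"
  shows "finite_limit U g \<longleftrightarrow> (\<exists>B::real. \<forall>\<^sub>F i in U. g i \<le> ennreal B)"
proof
  assume "finite_limit U g"
  then obtain l where l: "l < \<infinity>" "(g \<longlongrightarrow> l) U" by (auto simp: finite_limit_def)
  then obtain r where r: "0 \<le> r" "l = ennreal r" by (cases l) auto
  have "l < ennreal (r + 1)" using r by (simp add: ennreal_lessI)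
  from order_tendstoD(2)[OF l(2) this]
  have "\<forall>\<^sub>F i in U. g i \<le> ennreal (r + 1)" by eventually_elim simp
  then show "\<exists>B::real. \<forall>\<^sub>F i in U. g i \<le> ennreal B" by blast
next
  assume "\<exists>B::real. \<forall>\<^sub>F i in U. g i \<le> ennreal B"
  then obtain B where B: "\<forall>\<^sub>F i in U. g i \<le> ennreal B" by blast
  \<comment> \<open>\<open>B\<close> may be negative, and then \<open>ennreal B\<close> is 0; hence
    the bound \<open>max B 0\<close>.\<close>
  have "\<forall>\<^sub>F i in U. 0 \<le> enn2real (g i) \<and> enn2real (g i) \<le> max B 0"
    using B
  proof eventually_elim
    case (elim i)
    have "enn2real (g i) \<le> enn2real (ennreal B)" using elim by (intro enn2real_mono) auto
    then show ?case by (cases "B \<ge> 0") (auto simp: ennreal_neg)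
  qed
  then obtain l where l: "((\<lambda>i. enn2real (g i)) \<longlongrightarrow> l) U"
    by (rule ultrafilter_tendsto_real[OF U])
  have "((\<lambda>i. ennreal (enn2real (g i))) \<longlongrightarrow> ennreal l) U"
    by (intro tendsto_ennrealI l)
  moreover have "\<forall>\<^sub>F i in U. ennreal (enn2real (g i)) = g i"
    using B
  proof eventually_elim
    case (elim i)
    then show ?case using le_less_trans[OF elim ennreal_less_top] by simp
  qed
  ultimately have "(g \<longlongrightarrow> ennreal l) U" by (simp cong: tendsto_cong)
  then show "finite_limit U g" unfolding finite_limit_def
    by (metis ennreal_less_top infinity_ennreal_def)
qed

lemma tendsto_powr_cancel:
  fixes h :: "'i \<Rightarrow> real"
  assumes "((\<lambda>i. h i powr p) \<longlongrightarrow> r powr p) F" "\<And>i. 0 \<le> h i" "0 \<le> r" "0 < p"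
  shows "(h \<longlongrightarrow> r) F"
proof -
  have "((\<lambda>i. (h i powr p) powr (1 / p)) \<longlongrightarrow> (r powr p) powr (1 / p)) F"
    by (rule tendsto_powr'[OF assms(1) tendsto_const]) (use assms(4) in simp)
  then show ?thesis using assms(2-4) by (simp add: powr_powr)
qed

text \<open>Let \<open>M i\<close> be the first \<open>n\<close> at which \<open>i\<close> leaves
  \<open>A n\<close> or \<open>P n\<close> fails. It exists on a large set, as the intersection of
  the \<open>A n\<close> is not in the ultrafilter, and it exceeds every fixed \<open>k\<close> on a
  large set, as finite intersections of large sets are large.\<close>

lemma countably_incomplete_diagonal:
  assumes U: "ultrafilter U" and ci: "countably_incomplete U"
    and P: "\<And>n::nat. eventually (P n) U"
  obtains N :: "'i \<Rightarrow> nat" where "\<And>k. \<forall>\<^sub>F i in U. k \<le> N i" "\<forall>\<^sub>F i in U. P (N i) i"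
proof -
  obtain A :: "nat \<Rightarrow> 'i set" where A: "\<And>n. \<forall>\<^sub>F i in U. i \<in> A n" "\<not> (\<forall>\<^sub>F i in U. i \<in> (\<Inter>n. A n))"
    using ci unfolding countably_incomplete_def by blast
  define R where "R n i \<longleftrightarrow> i \<in> A n \<and> P n i" for n i
  have R: "eventually (R n) U" for n
    unfolding R_def using A(1) P by (rule eventually_conj)
  define M where "M i = (LEAST n. \<not> R n i)" for i
  \<comment> \<open>The last index before the first failure, so that \<open>R (N i) i\<close> still
    holds. This is meaningful only where \<open>M i\<close> is positive, which is eventually the
    case.\<close>
  define N where "N i = M i - 1" for i
  have ex: "\<forall>\<^sub>F i in U. \<exists>n. \<not> R n i"
    using ultrafilter_nonevD[OF U A(2)] by eventually_elim (auto simp: R_def)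
  have M: "\<forall>\<^sub>F i in U. k \<le> M i" for k
  proof -
    have "\<forall>\<^sub>F i in U. \<forall>n\<in>{..<k}. R n i" by (simp add: eventually_ball_finite R)
    with ex show ?thesis
    proof eventually_elim
      case (elim i)
      have "\<not> R (M i) i" unfolding M_def using elim(1) by (rule LeastI_ex)
      then show ?case using elim(2) by (meson lessThan_iff not_le)
    qed
  qed
  have "\<forall>\<^sub>F i in U. k \<le> N i" for k
    using M[of "Suc k"] by eventually_elim (auto simp: N_def)
  moreover have "\<forall>\<^sub>F i in U. P (N i) i"
    using M[of 1]
  proof eventually_elim
    case (elim i)
    then have "N i < (LEAST n. \<not> R n i)" by (auto simp: N_def M_def)
    then show ?case using not_less_Least by (fastforce simp: R_def)
  qed
  ultimately show thesis by (rule that)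
qed

section \<open>Arithmetic and norm estimates in one p-normed space\<close>

context p_normed_space
begin

lemma smult_real_closed [simp]: "x \<in> carrier X \<Longrightarrow> t \<odot>\<^bsub>X\<^esub> x \<in> carrier X"
  by (rule smult_closed) simp_all

lemma smult_real_add: "x \<in> carrier X \<Longrightarrow> y \<in> carrier X \<Longrightarrow> t \<odot>\<^bsub>X\<^esub> (x \<oplus>\<^bsub>X\<^esub> y) = t \<odot>\<^bsub>X\<^esub> x \<oplus>\<^bsub>X\<^esub> t \<odot>\<^bsub>X\<^esub> y"
  by (rule smult_r_distr) simp_all

lemma smult_real_zero_left [simp]: "x \<in> carrier X \<Longrightarrow> 0 \<odot>\<^bsub>X\<^esub> x = \<zero>\<^bsub>X\<^esub>"
  using smult_l_null by simp

lemma smult_real_zero_right [simp]: "t \<odot>\<^bsub>X\<^esub> \<zero>\<^bsub>X\<^esub> = \<zero>\<^bsub>X\<^esub>"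
  using smult_r_null by simp

lemma smult_real_one [simp]: "x \<in> carrier X \<Longrightarrow> 1 \<odot>\<^bsub>X\<^esub> x = x"
  using smult_one by simp

lemma smult_real_minus: "x \<in> carrier X \<Longrightarrow> t \<odot>\<^bsub>X\<^esub> (\<ominus>\<^bsub>X\<^esub> x) = \<ominus>\<^bsub>X\<^esub> (t \<odot>\<^bsub>X\<^esub> x)"
  by (rule smult_r_minus) simp_all

lemma smult_real_diff:
  "x \<in> carrier X \<Longrightarrow> y \<in> carrier X \<Longrightarrow> t \<odot>\<^bsub>X\<^esub> (x \<ominus>\<^bsub>X\<^esub> y) = t \<odot>\<^bsub>X\<^esub> x \<ominus>\<^bsub>X\<^esub> t \<odot>\<^bsub>X\<^esub> y"
  by (simp add: minus_eq smult_real_add smult_real_minus)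

lemma add_diff_self: "x \<in> carrier X \<Longrightarrow> y \<in> carrier X \<Longrightarrow> (x \<ominus>\<^bsub>X\<^esub> y) \<oplus>\<^bsub>X\<^esub> y = x"
  by (simp add: minus_eq a_assoc l_neg)

lemma diff_add_self: "x \<in> carrier X \<Longrightarrow> y \<in> carrier X \<Longrightarrow> (x \<oplus>\<^bsub>X\<^esub> y) \<ominus>\<^bsub>X\<^esub> y = x"
  by (simp add: minus_eq a_assoc r_neg)

lemma diff_diff_add: "x \<in> carrier X \<Longrightarrow> y \<in> carrier X \<Longrightarrow> z \<in> carrier X \<Longrightarrow>
   x \<ominus>\<^bsub>X\<^esub> y \<ominus>\<^bsub>X\<^esub> z = x \<ominus>\<^bsub>X\<^esub> (y \<oplus>\<^bsub>X\<^esub> z)"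
  by (simp add: minus_eq a_assoc minus_add)

lemma diff_diff_add_cancel:
  assumes "x \<in> carrier X" "y \<in> carrier X" "z \<in> carrier X"
  shows "(x \<ominus>\<^bsub>X\<^esub> y \<ominus>\<^bsub>X\<^esub> z) \<oplus>\<^bsub>X\<^esub> y = x \<ominus>\<^bsub>X\<^esub> z"
proof -
  have "x \<ominus>\<^bsub>X\<^esub> y \<ominus>\<^bsub>X\<^esub> z = x \<ominus>\<^bsub>X\<^esub> z \<ominus>\<^bsub>X\<^esub> y"
    using assms by (simp add: minus_eq a_ac)
  then show ?thesis using assms by (simp add: add_diff_self)
qed

lemma diff_zero [simp]: "x \<in> carrier X \<Longrightarrow> x \<ominus>\<^bsub>X\<^esub> \<zero>\<^bsub>X\<^esub> = x"
  by (simp add: minus_eq)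

lemma diff_self [simp]: "x \<in> carrier X \<Longrightarrow> x \<ominus>\<^bsub>X\<^esub> x = \<zero>\<^bsub>X\<^esub>"
  by (simp add: minus_eq r_neg)

lemma nrm_zero [simp]: "nrm X \<zero>\<^bsub>X\<^esub> = 0"
  using nrm_smult[of "\<zero>\<^bsub>X\<^esub>" 0] by simp

lemma nrm_minus [simp]:
  assumes x: "x \<in> carrier X" shows "nrm X (\<ominus>\<^bsub>X\<^esub> x) = nrm X x"
proof -
  have "x \<oplus>\<^bsub>X\<^esub> (-1) \<odot>\<^bsub>X\<^esub> x = 1 \<odot>\<^bsub>X\<^esub> x \<oplus>\<^bsub>X\<^esub> (-1) \<odot>\<^bsub>X\<^esub> x" using x by simp
  also have "\<dots> = (1 \<oplus>\<^bsub>real_ring\<^esub> (-1)) \<odot>\<^bsub>X\<^esub> x" using x by (intro smult_l_distr[symmetric]) simp_all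
  also have "\<dots> = \<zero>\<^bsub>X\<^esub>" using x by simp
  finally have "(-1) \<odot>\<^bsub>X\<^esub> x = \<ominus>\<^bsub>X\<^esub> x" using x
    by (metis minus_equality minus_minus smult_real_closed a_inv_closed)
  then show ?thesis using nrm_smult[OF x, of "-1"] by simp
qed

lemma nrm_pos_iff: "x \<in> carrier X \<Longrightarrow> 0 < nrm X x \<longleftrightarrow> x \<noteq> \<zero>\<^bsub>X\<^esub>"
  using nrm_nonneg nrm_eq_0_imp by fastforce

text \<open>Both p-th powers on the right of \<open>nrm_add\<close> are at most the p-th power of
  the sum of the norms; the factor 2 becomes 2 powr (1/p) on taking roots.\<close>

lemma nrm_add_quasi:
  assumes "x \<in> carrier X" "y \<in> carrier X"
  shows "nrm X (x \<oplus>\<^bsub>X\<^esub> y) \<le> 2 powr (1 / p) * (nrm X x + nrm X y)"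
proof -
  let ?m = "nrm X x + nrm X y"
  have nn: "0 \<le> nrm X x" "0 \<le> nrm X y" "0 \<le> nrm X (x \<oplus>\<^bsub>X\<^esub> y)"
    using assms by (auto intro: nrm_nonneg)
  have "nrm X x powr p \<le> ?m powr p" "nrm X y powr p \<le> ?m powr p"
    using nn p_pos by (auto intro!: powr_mono2)
  then have "nrm X (x \<oplus>\<^bsub>X\<^esub> y) powr p \<le> 2 * ?m powr p"
    using nrm_add[OF assms] by simp
  then have "(nrm X (x \<oplus>\<^bsub>X\<^esub> y) powr p) powr (1 / p) \<le> (2 * ?m powr p) powr (1 / p)"
    using p_pos by (intro powr_mono2) auto
  then show ?thesis
    using nn p_pos by (simp add: powr_powr powr_mult)
qed

lemma nrm_diff_commute:
  assumes "x \<in> carrier X" "y \<in> carrier X"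
  shows "nrm X (y \<ominus>\<^bsub>X\<^esub> x) = nrm X (x \<ominus>\<^bsub>X\<^esub> y)"
proof -
  have "y \<ominus>\<^bsub>X\<^esub> x = \<ominus>\<^bsub>X\<^esub> (x \<ominus>\<^bsub>X\<^esub> y)"
    using assms by (simp add: minus_eq minus_add a_comm)
  then show ?thesis using assms by simp
qed

text \<open>The reverse triangle inequality for the metric given by the p-th power of the norm of a
  difference; it makes the norm continuous.\<close>

lemma nrm_powr_diff_le:
  assumes "x \<in> carrier X" "y \<in> carrier X"
  shows "\<bar>nrm X x powr p - nrm X y powr p\<bar> \<le> nrm X (x \<ominus>\<^bsub>X\<^esub> y) powr p"
  using nrm_add[of "x \<ominus>\<^bsub>X\<^esub> y" y] nrm_add[of "y \<ominus>\<^bsub>X\<^esub> x" x] assms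
  by (simp add: add_diff_self nrm_diff_commute[of x y])

lemma nrm_normalize:
  assumes "x \<in> carrier X" "x \<noteq> \<zero>\<^bsub>X\<^esub>"
  shows "nrm X ((1 / nrm X x) \<odot>\<^bsub>X\<^esub> x) = 1"
  using nrm_smult[OF assms(1), of "1 / nrm X x"] nrm_pos_iff[OF assms(1)] assms(2) by auto

end

section \<open>Homogeneous maps: norm and quasilinearity constant as pointwise bounds\<close>

locale homogeneous_between = X: p_normed_space p X + Y: p_normed_space p Y
  for p and X :: "'a normed_module" and Y :: "'b normed_module" +
  fixes g :: "'a \<Rightarrow> 'b"
  assumes hom: "homogeneous_map X Y g"
begin

lemma closed [simp]: "x \<in> carrier X \<Longrightarrow> g x \<in> carrier Y"
  using hom by (auto simp: homogeneous_map_def)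

lemma smult: "x \<in> carrier X \<Longrightarrow> g (t \<odot>\<^bsub>X\<^esub> x) = t \<odot>\<^bsub>Y\<^esub> g x"
  using hom by (auto simp: homogeneous_map_def)

lemma zero [simp]: "g \<zero>\<^bsub>X\<^esub> = \<zero>\<^bsub>Y\<^esub>"
  using smult[of "\<zero>\<^bsub>X\<^esub>" 0] by simp

text \<open>Scaling to the unit sphere trades the supremum for a bound at every vector. The zero
  vector cannot be scaled, but homogeneity sends it to zero.\<close>

lemma map_norm_le_iff:
  assumes C: "0 \<le> C"
  shows "map_norm X Y g \<le> ennreal C \<longleftrightarrow> (\<forall>x\<in>carrier X. nrm Y (g x) \<le> C * nrm X x)"
proof
  assume le: "map_norm X Y g \<le> ennreal C"
  show "\<forall>x\<in>carrier X. nrm Y (g x) \<le> C * nrm X x"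
  proof
    fix x assume x: "x \<in> carrier X"
    show "nrm Y (g x) \<le> C * nrm X x"
    proof (cases "x = \<zero>\<^bsub>X\<^esub>")
      case False
      let ?y = "(1 / nrm X x) \<odot>\<^bsub>X\<^esub> x"
      have pos: "0 < nrm X x" using x False by (simp add: X.nrm_pos_iff)
      have y: "?y \<in> carrier X" "nrm X ?y = 1" using x False by (auto intro: X.nrm_normalize)
      have "ennreal (nrm Y (g ?y)) \<le> map_norm X Y g"
        unfolding map_norm_def using y by (intro SUP_upper) auto
      with le have "ennreal (nrm Y (g ?y)) \<le> ennreal C" by simp
      then have "nrm Y (g ?y) \<le> C" using C by (simp add: ennreal_le_iff)
      then show ?thesis using x pos by (simp add: smult Y.nrm_smult field_simps)
    qed simp
  qed
next
  assume *: "\<forall>x\<in>carrier X. nrm Y (g x) \<le> C * nrm X x"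
  show "map_norm X Y g \<le> ennreal C"
    unfolding map_norm_def
  proof (rule SUP_least)
    fix x assume "x \<in> {x \<in> carrier X. nrm X x = 1}"
    then show "ennreal (nrm Y (g x)) \<le> ennreal C"
      using *[rule_format, of x] by (auto intro: ennreal_leI)
  qed
qed

end

text \<open>The strict inequality yields an admissible constant below \<open>Q\<close>, so
  attainment of the infimum need not be proved.\<close>

lemma quasilinearity_le_imp:
  assumes "quasilinearity X Y g < ennreal Q" "x \<in> carrier X" "y \<in> carrier X"
    and nn: "0 \<le> nrm X x" "0 \<le> nrm X y"
  shows "nrm Y (g (x \<oplus>\<^bsub>X\<^esub> y) \<ominus>\<^bsub>Y\<^esub> g x \<ominus>\<^bsub>Y\<^esub> g y) \<le> Q * (nrm X x + nrm X y)"
proof -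
  obtain Q' where Q': "ennreal Q' < ennreal Q" "0 \<le> Q'"
     "nrm Y (g (x \<oplus>\<^bsub>X\<^esub> y) \<ominus>\<^bsub>Y\<^esub> g x \<ominus>\<^bsub>Y\<^esub> g y) \<le> Q' * (nrm X x + nrm X y)"
    using assms(1-3) unfolding quasilinearity_def Inf_less_iff by blast
  then have "Q' \<le> Q" by (simp add: ennreal_less_iff)
  then have "Q' * (nrm X x + nrm X y) \<le> Q * (nrm X x + nrm X y)"
    using nn by (intro mult_right_mono) auto
  with Q'(3) show ?thesis by simp
qed

lemma quasilinearity_le:
  assumes "0 \<le> Q" "\<And>x y. x \<in> carrier X \<Longrightarrow> y \<in> carrier X \<Longrightarrow>
     nrm Y (g (x \<oplus>\<^bsub>X\<^esub> y) \<ominus>\<^bsub>Y\<^esub> g x \<ominus>\<^bsub>Y\<^esub> g y) \<le> Q * (nrm X x + nrm X y)"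
  shows "quasilinearity X Y g \<le> ennreal Q"
  unfolding quasilinearity_def using assms by (intro Inf_lower) auto

lemma ennreal_tendsto_0_iff_le:
  "((g :: 'i \<Rightarrow> ennreal) \<longlongrightarrow> 0) U \<longleftrightarrow> (\<forall>e>0. \<forall>\<^sub>F i in U. g i \<le> ennreal e)"
proof
  assume *: "(g \<longlongrightarrow> 0) U"
  show "\<forall>e>0. \<forall>\<^sub>F i in U. g i \<le> ennreal e"
  proof (intro allI impI)
    fix e :: real assume "0 < e"
    then have "\<forall>\<^sub>F i in U. g i < ennreal e"
      by (intro order_tendstoD(2)[OF *]) simp
    then show "\<forall>\<^sub>F i in U. g i \<le> ennreal e"
      by eventually_elim simp
  qed
next
  assume *: "\<forall>e>0. \<forall>\<^sub>F i in U. g i \<le> ennreal e"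
  show "(g \<longlongrightarrow> 0) U"
  proof (rule order_tendstoI)
    fix a :: ennreal assume "0 < a"
    \<comment> \<open>\<open>a\<close> may be infinite; a value strictly below it is finite and
      hence comes from a real.\<close>
    then obtain b where b: "0 < b" "b < a" using dense by blast
    then obtain r where r: "b = ennreal r" "0 < r" by (cases b) (auto simp: top_unique)
    show "\<forall>\<^sub>F i in U. g i < a" using *[rule_format, OF r(2)]
      by eventually_elim (use b r in auto)
  qed auto
qed

section \<open>Families, null families and the ultraproduct\<close>

locale p_normed_family =
  fixes p :: real and U :: "'i filter" and X :: "'i \<Rightarrow> 'a normed_module"
  assumes ultra: "ultrafilter U" and p_normed: "\<And>i. p_normed_space p (X i)"
begin

sublocale comp: p_normed_space p "X i" for i
  by (rule p_normed)

lemma ev_not: "\<not> eventually P U \<Longrightarrow> \<forall>\<^sub>F i in U. \<not> P i"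
  by (rule ultrafilter_nonevD[OF ultra])

lemma nontrivial [simp]: "U \<noteq> bot"
  using ultra by (simp add: ultrafilter_def)

lemma family_carrier_iff:
  "x \<in> carrier (family_space U X) \<longleftrightarrow>
     (\<forall>i. x i \<in> carrier (X i)) \<and> (\<exists>B. \<forall>\<^sub>F i in U. nrm (X i) (x i) \<le> B)"
proof -
  have "(\<exists>B::real. \<forall>\<^sub>F i in U. ennreal (nrm (X i) (x i)) \<le> ennreal B) \<longleftrightarrow>
        (\<exists>B. \<forall>\<^sub>F i in U. nrm (X i) (x i) \<le> B)"
  proof (intro iffI; elim exE)
    fix B :: real assume "\<forall>\<^sub>F i in U. ennreal (nrm (X i) (x i)) \<le> ennreal B"
    then have "\<forall>\<^sub>F i in U. nrm (X i) (x i) \<le> max B 0"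
      by eventually_elim (auto simp: ennreal_le_iff2)
    then show "\<exists>B. \<forall>\<^sub>F i in U. nrm (X i) (x i) \<le> B" by blast
  next
    fix B assume "\<forall>\<^sub>F i in U. nrm (X i) (x i) \<le> B"
    then have "\<forall>\<^sub>F i in U. ennreal (nrm (X i) (x i)) \<le> ennreal B"
      by eventually_elim (rule ennreal_leI)
    then show "\<exists>B::real. \<forall>\<^sub>F i in U. ennreal (nrm (X i) (x i)) \<le> ennreal B" by blast
  qed
  then show ?thesis
    by (simp add: family_space_def finite_limit_iff_ev_bounded[OF ultra])
qed

lemma family_carrier_nth: "x \<in> carrier (family_space U X) \<Longrightarrow> x i \<in> carrier (X i)"
  by (simp add: family_carrier_iff)

lemma bounded_family_carrier: "bounded_family X x \<Longrightarrow> x \<in> carrier (family_space U X)"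
  by (auto simp: bounded_family_def family_carrier_iff intro: always_eventually)

lemma null_families_iff:
  "x \<in> null_families U X \<longleftrightarrow> (\<forall>i. x i \<in> carrier (X i)) \<and> ((\<lambda>i. nrm (X i) (x i)) \<longlongrightarrow> 0) U"
proof -
  have "\<exists>B. \<forall>\<^sub>F i in U. nrm (X i) (x i) \<le> B" if "((\<lambda>i. nrm (X i) (x i)) \<longlongrightarrow> 0) U"
    using order_tendstoD(2)[OF that, of 1] by (auto intro: exI[of _ 1] elim!: eventually_mono)
  then show ?thesis by (auto simp: null_families_def family_carrier_iff)
qed

lemma dominated_null:
  assumes "\<And>i. 0 \<le> h i" "\<forall>\<^sub>F i in U. h i \<le> g i" "(g \<longlongrightarrow> (0::real)) U"
  shows "(h \<longlongrightarrow> 0) U"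
  by (rule tendsto_sandwich[OF _ assms(2) tendsto_const assms(3)]) (simp add: assms(1))

lemma null_add:
  assumes "\<And>i. x i \<in> carrier (X i)" "\<And>i. y i \<in> carrier (X i)"
    "((\<lambda>i. nrm (X i) (x i)) \<longlongrightarrow> 0) U" "((\<lambda>i. nrm (X i) (y i)) \<longlongrightarrow> 0) U"
  shows "((\<lambda>i. nrm (X i) (x i \<oplus>\<^bsub>X i\<^esub> y i)) \<longlongrightarrow> 0) U"
proof (rule dominated_null)
  show "\<forall>\<^sub>F i in U. nrm (X i) (x i \<oplus>\<^bsub>X i\<^esub> y i)
      \<le> 2 powr (1 / p) * (nrm (X i) (x i) + nrm (X i) (y i))"
    by (simp add: assms comp.nrm_add_quasi)
  show "((\<lambda>i. 2 powr (1 / p) * (nrm (X i) (x i) + nrm (X i) (y i))) \<longlongrightarrow> 0) U"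
    using tendsto_mult[OF tendsto_const tendsto_add[OF assms(3,4)]] by simp
qed (simp add: assms comp.nrm_nonneg)

lemma family_add_closed:
  assumes x: "x \<in> carrier (family_space U X)" and y: "y \<in> carrier (family_space U X)"
  shows "(\<lambda>i. x i \<oplus>\<^bsub>X i\<^esub> y i) \<in> carrier (family_space U X)"
proof -
  obtain B C where BC: "\<forall>\<^sub>F i in U. nrm (X i) (x i) \<le> B" "\<forall>\<^sub>F i in U. nrm (X i) (y i) \<le> C"
    using x y by (auto simp: family_carrier_iff)
  have "\<forall>\<^sub>F i in U. nrm (X i) (x i \<oplus>\<^bsub>X i\<^esub> y i) \<le> 2 powr (1 / p) * (B + C)"
    using BC
  proof eventually_elim
    case (elim i)
    have "nrm (X i) (x i \<oplus>\<^bsub>X i\<^esub> y i) \<le> 2 powr (1 / p) * (nrm (X i) (x i) + nrm (X i) (y i))"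
      by (simp add: comp.nrm_add_quasi family_carrier_nth x y)
    also have "\<dots> \<le> 2 powr (1 / p) * (B + C)"
      using elim by (intro mult_left_mono) auto
    finally show ?case .
  qed
  then show ?thesis using x y by (auto simp: family_carrier_iff)
qed

lemma family_smult_closed:
  assumes x: "x \<in> carrier (family_space U X)"
  shows "(\<lambda>i. t \<odot>\<^bsub>X i\<^esub> x i) \<in> carrier (family_space U X)"
proof -
  obtain B where B: "\<forall>\<^sub>F i in U. nrm (X i) (x i) \<le> B"
    using x by (auto simp: family_carrier_iff)
  then have "\<forall>\<^sub>F i in U. nrm (X i) (t \<odot>\<^bsub>X i\<^esub> x i) \<le> \<bar>t\<bar> * B"
    by eventually_elim (use x in \<open>simp add: comp.nrm_smult family_carrier_nth mult_left_mono\<close>)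
  then show ?thesis using x by (auto simp: family_carrier_iff)
qed

lemma family_minus_closed:
  assumes x: "x \<in> carrier (family_space U X)"
  shows "(\<lambda>i. \<ominus>\<^bsub>X i\<^esub> x i) \<in> carrier (family_space U X)"
  using x by (simp add: family_carrier_iff)

lemma zero_family_null: "(\<lambda>i. \<zero>\<^bsub>X i\<^esub>) \<in> null_families U X"
  by (simp add: null_families_iff)

lemma family_space_add: "x \<oplus>\<^bsub>family_space U X\<^esub> y = (\<lambda>i. x i \<oplus>\<^bsub>X i\<^esub> y i)"
  and family_space_zero: "\<zero>\<^bsub>family_space U X\<^esub> = (\<lambda>i. \<zero>\<^bsub>X i\<^esub>)"
  and family_space_smult: "t \<odot>\<^bsub>family_space U X\<^esub> x = (\<lambda>i. t \<odot>\<^bsub>X i\<^esub> x i)"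
  by (simp_all add: family_space_def)

lemma abelian_group_family_space: "abelian_group (family_space U X)"
proof (rule abelian_groupI)
  fix x assume x: "x \<in> carrier (family_space U X)"
  have "(\<lambda>i. \<ominus>\<^bsub>X i\<^esub> x i) \<oplus>\<^bsub>family_space U X\<^esub> x = \<zero>\<^bsub>family_space U X\<^esub>"
    using x by (simp add: family_space_add family_space_zero family_carrier_nth comp.l_neg)
  then show "\<exists>y\<in>carrier (family_space U X). y \<oplus>\<^bsub>family_space U X\<^esub> x = \<zero>\<^bsub>family_space U X\<^esub>"
    using family_minus_closed[OF x] by blast
next
  show "\<zero>\<^bsub>family_space U X\<^esub> \<in> carrier (family_space U X)"
    using zero_family_null by (simp add: family_space_zero null_families_def)
qed (simp_all add: family_space_add family_space_zero family_add_closed family_carrier_nth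
      comp.a_assoc comp.a_comm comp.a_lcomm)

sublocale family: abelian_group "family_space U X"
  by (rule abelian_group_family_space)

lemma family_space_minus:
  assumes x: "x \<in> carrier (family_space U X)"
  shows "\<ominus>\<^bsub>family_space U X\<^esub> x = (\<lambda>i. \<ominus>\<^bsub>X i\<^esub> x i)"
  using x by (intro family.minus_equality)
    (simp_all add: family_minus_closed family_space_add family_space_zero family_carrier_nth comp.l_neg)

text \<open>Gives access to the coset theory of abelian groups, from which disjointness of classes
  and their addition are taken.\<close>

lemma subgroup_null_families: "subgroup (null_families U X) (add_monoid (family_space U X))"
proof (rule family.add.subgroupI)
  show "null_families U X \<subseteq> carrier (family_space U X)"
    by (auto simp: null_families_def)
  show "null_families U X \<noteq> {}" using zero_family_null by auto
next
  fix x assume x: "x \<in> null_families U X"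
  then have "x \<in> carrier (family_space U X)" by (simp add: null_families_def)
  from family_space_minus[OF this] x
  show "\<ominus>\<^bsub>family_space U X\<^esub> x \<in> null_families U X"
    by (simp add: null_families_iff)
next
  fix x y assume "x \<in> null_families U X" "y \<in> null_families U X"
  then show "x \<oplus>\<^bsub>family_space U X\<^esub> y \<in> null_families U X"
    by (simp add: null_families_iff family_space_add null_add)
qed

sublocale null: abelian_subgroup "null_families U X" "family_space U X"
  by (intro abelian_subgroupI3 additive_subgroupI subgroup_null_families abelian_group_family_space)

lemma in_ultraclass_iff:
  assumes x: "x \<in> carrier (family_space U X)"
  shows "y \<in> ultraclass U X x \<longleftrightarrow>
    (\<forall>i. y i \<in> carrier (X i)) \<and> ((\<lambda>i. nrm (X i) (y i \<ominus>\<^bsub>X i\<^esub> x i)) \<longlongrightarrow> 0) U"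
proof -
  have "y \<in> ultraclass U X x \<longleftrightarrow> (\<exists>n\<in>null_families U X. y = (\<lambda>i. n i \<oplus>\<^bsub>X i\<^esub> x i))"
    by (simp add: ultraclass_def a_r_coset_def' family_space_add)
  also have "\<dots> \<longleftrightarrow> (\<forall>i. y i \<in> carrier (X i)) \<and> (\<lambda>i. y i \<ominus>\<^bsub>X i\<^esub> x i) \<in> null_families U X"
  proof (intro iffI; (elim bexE)?; (elim conjE)?)
    fix n assume "n \<in> null_families U X" "y = (\<lambda>i. n i \<oplus>\<^bsub>X i\<^esub> x i)"
    then show "(\<forall>i. y i \<in> carrier (X i)) \<and> (\<lambda>i. y i \<ominus>\<^bsub>X i\<^esub> x i) \<in> null_families U X"
      using x by (simp add: null_families_iff family_carrier_nth comp.diff_add_self)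
  next
    assume *: "\<forall>i. y i \<in> carrier (X i)" "(\<lambda>i. y i \<ominus>\<^bsub>X i\<^esub> x i) \<in> null_families U X"
    show "\<exists>n\<in>null_families U X. y = (\<lambda>i. n i \<oplus>\<^bsub>X i\<^esub> x i)"
      using x * by (intro bexI[OF _ *(2)]) (simp add: family_carrier_nth comp.add_diff_self)
  qed
  also have "\<dots> \<longleftrightarrow> (\<forall>i. y i \<in> carrier (X i)) \<and> ((\<lambda>i. nrm (X i) (y i \<ominus>\<^bsub>X i\<^esub> x i)) \<longlongrightarrow> 0) U"
    using x by (auto simp: null_families_iff family_carrier_nth)
  finally show ?thesis .
qed

lemma ultraclass_self: "x \<in> carrier (family_space U X) \<Longrightarrow> x \<in> ultraclass U X x"
  by (simp add: in_ultraclass_iff family_carrier_nth)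

lemma ultraclass_subset:
  "x \<in> carrier (family_space U X) \<Longrightarrow> ultraclass U X x \<subseteq> carrier (family_space U X)"
  unfolding ultraclass_def by (rule family.a_r_coset_subset_G[OF null.a_subset])

text \<open>Cosets of a subgroup are equal as soon as one contains a representative of the other, so
  equality of classes is the membership test \<open>in_ultraclass_iff\<close>.\<close>

lemma ultraclass_eq_iff:
  assumes x: "x \<in> carrier (family_space U X)" and y: "y \<in> carrier (family_space U X)"
  shows "ultraclass U X x = ultraclass U X y \<longleftrightarrow> ((\<lambda>i. nrm (X i) (x i \<ominus>\<^bsub>X i\<^esub> y i)) \<longlongrightarrow> 0) U"
proof -
  have "ultraclass U X y = ultraclass U X x" if "x \<in> ultraclass U X y"
    using family.a_repr_independence[OF _ y subgroup_null_families] that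
    by (simp add: ultraclass_def)
  then have "ultraclass U X x = ultraclass U X y \<longleftrightarrow> x \<in> ultraclass U X y"
    using ultraclass_self[OF x] by auto
  then show ?thesis using x by (simp add: in_ultraclass_iff[OF y] family_carrier_nth)
qed

lemma carrier_ultraproduct: "carrier (ultraproduct U X) = ultraclass U X ` carrier (family_space U X)"
  by (auto simp: ultraproduct_def A_RCOSETS_def' ultraclass_def)

lemma ultraproduct_add:
  "x \<in> carrier (family_space U X) \<Longrightarrow> y \<in> carrier (family_space U X) \<Longrightarrow>
   ultraclass U X x \<oplus>\<^bsub>ultraproduct U X\<^esub> ultraclass U X y = ultraclass U X (\<lambda>i. x i \<oplus>\<^bsub>X i\<^esub> y i)"
  using null.a_rcos_sum[of x y] by (simp add: ultraproduct_def ultraclass_def family_space_add)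

lemma ultraproduct_smult:
  assumes x: "x \<in> carrier (family_space U X)"
  shows "t \<odot>\<^bsub>ultraproduct U X\<^esub> ultraclass U X x = ultraclass U X (\<lambda>i. t \<odot>\<^bsub>X i\<^esub> x i)"
proof -
  have "ultraclass U X (\<lambda>i. t \<odot>\<^bsub>X i\<^esub> y i) = ultraclass U X (\<lambda>i. t \<odot>\<^bsub>X i\<^esub> x i)"
    if "y \<in> ultraclass U X x" for y
  proof -
    have y: "y \<in> carrier (family_space U X)" using that ultraclass_subset[OF x] by blast
    have "((\<lambda>i. nrm (X i) (y i \<ominus>\<^bsub>X i\<^esub> x i)) \<longlongrightarrow> 0) U" using that x by (simp add: in_ultraclass_iff)
    from tendsto_mult[OF tendsto_const[of "\<bar>t\<bar>"] this]
    have "((\<lambda>i. nrm (X i) (t \<odot>\<^bsub>X i\<^esub> y i \<ominus>\<^bsub>X i\<^esub> t \<odot>\<^bsub>X i\<^esub> x i)) \<longlongrightarrow> 0) U"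
      using x y by (simp add: comp.smult_real_diff[symmetric] comp.nrm_smult family_carrier_nth)
    then show ?thesis using x y by (simp add: ultraclass_eq_iff family_smult_closed)
  qed
  \<comment> \<open>All sets in the union that defines scalar multiplication coincide, and the index
    set is nonempty, so the union is that common class. This covers \<open>t = 0\<close> as
    well.\<close>
  then have "(\<Union>y\<in>ultraclass U X x. ultraclass U X (\<lambda>i. t \<odot>\<^bsub>X i\<^esub> y i)) =
      (\<Union>y\<in>ultraclass U X x. ultraclass U X (\<lambda>i. t \<odot>\<^bsub>X i\<^esub> x i))"
    by (rule SUP_cong[OF refl])
  also have "\<dots> = ultraclass U X (\<lambda>i. t \<odot>\<^bsub>X i\<^esub> x i)"
  proof (rule cSUP_const)
    show "ultraclass U X x \<noteq> {}" using ultraclass_self[OF x] by blast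
  qed
  finally show ?thesis by (simp add: ultraproduct_def family_space_smult)
qed

lemma family_norm_tendsto:
  assumes x: "x \<in> carrier (family_space U X)"
  obtains r where "((\<lambda>i. nrm (X i) (x i)) \<longlongrightarrow> r) U"
proof -
  obtain B where "\<forall>\<^sub>F i in U. nrm (X i) (x i) \<le> B"
    using x by (auto simp: family_carrier_iff)
  then have "\<forall>\<^sub>F i in U. 0 \<le> nrm (X i) (x i) \<and> nrm (X i) (x i) \<le> B"
    by eventually_elim (simp add: x family_carrier_nth comp.nrm_nonneg)
  then show thesis by (rule ultrafilter_tendsto_real[OF ultra]) (rule that)
qed

text \<open>Shows that the definite description in the norm is legitimate: by
  \<open>nrm_powr_diff_le\<close>, p-th powers of the norms of two members of a class differ by a
  null function, and taking roots gives the same limit.\<close>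

lemma ultraproduct_nrm:
  assumes x: "x \<in> carrier (family_space U X)" and r: "((\<lambda>i. nrm (X i) (x i)) \<longlongrightarrow> r) U"
  shows "nrm (ultraproduct U X) (ultraclass U X x) = r"
proof -
  have p: "0 < p" by (rule comp.p_pos)
  have "((\<lambda>i. nrm (X i) (y i)) \<longlongrightarrow> r) U" if y: "y \<in> ultraclass U X x" for y
  proof -
    have yc: "y \<in> carrier (family_space U X)" using y ultraclass_subset[OF x] by blast
    have "((\<lambda>i. nrm (X i) (y i \<ominus>\<^bsub>X i\<^esub> x i)) \<longlongrightarrow> 0) U" using y x by (simp add: in_ultraclass_iff)
    then have "((\<lambda>i. nrm (X i) (y i \<ominus>\<^bsub>X i\<^esub> x i) powr p) \<longlongrightarrow> 0 powr p) U"
      using p by (intro tendsto_powr') (auto simp: x yc family_carrier_nth comp.nrm_nonneg)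
    then have d: "((\<lambda>i. nrm (X i) (y i \<ominus>\<^bsub>X i\<^esub> x i) powr p) \<longlongrightarrow> 0) U"
      using p by simp
    have "((\<lambda>i. \<bar>nrm (X i) (y i) powr p - nrm (X i) (x i) powr p\<bar>) \<longlongrightarrow> 0) U"
      by (rule dominated_null[OF abs_ge_zero _ d]) (simp add: x yc family_carrier_nth comp.nrm_powr_diff_le)
    then have "((\<lambda>i. nrm (X i) (y i) powr p - nrm (X i) (x i) powr p) \<longlongrightarrow> 0) U"
      by (rule tendsto_rabs_zero_cancel)
    moreover have "((\<lambda>i. nrm (X i) (x i) powr p) \<longlongrightarrow> r powr p) U"
      using p by (intro tendsto_powr' r) (auto simp: x family_carrier_nth comp.nrm_nonneg)
    ultimately have "((\<lambda>i. (nrm (X i) (y i) powr p - nrm (X i) (x i) powr p) + nrm (X i) (x i) powr p)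
        \<longlongrightarrow> 0 + r powr p) U"
      by (rule tendsto_add)
    then have conv: "((\<lambda>i. nrm (X i) (y i) powr p) \<longlongrightarrow> r powr p) U"
      by simp
    \<comment> \<open>Needed to recover \<open>r\<close> from \<open>r powr p\<close>.\<close>
    have "0 \<le> r"
      by (rule tendsto_lowerbound[OF r]) (simp_all add: x family_carrier_nth comp.nrm_nonneg)
    then show ?thesis
      by (rule tendsto_powr_cancel[OF conv _ _ p, rotated]) (simp add: yc family_carrier_nth comp.nrm_nonneg)
  qed
  then have "(THE r. \<forall>y\<in>ultraclass U X x. ((\<lambda>i. nrm (X i) (y i)) \<longlongrightarrow> r) U) = r"
  proof (intro the_equality ballI)
    fix s assume "\<forall>y\<in>ultraclass U X x. ((\<lambda>i. nrm (X i) (y i)) \<longlongrightarrow> s) U"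
    then have "((\<lambda>i. nrm (X i) (x i)) \<longlongrightarrow> s) U" using ultraclass_self[OF x] by (rule bspec)
    then show "s = r" using r by (rule tendsto_unique[OF nontrivial])
  qed
  then show ?thesis by (simp add: ultraproduct_def)
qed

text \<open>\<open>induces\<close> tests only families bounded at every index, whereas members of
  \<open>family_space\<close> are bounded on a large set. Putting zero elsewhere keeps the
  class.\<close>

lemma bounded_representative:
  assumes "A \<in> carrier (ultraproduct U X)"
  obtains x where "bounded_family X x" "A = ultraclass U X x"
proof -
  obtain y where y: "y \<in> carrier (family_space U X)" "A = ultraclass U X y"
    using assms by (auto simp: carrier_ultraproduct)
  then obtain B where B: "\<forall>\<^sub>F i in U. nrm (X i) (y i) \<le> B"
    by (auto simp: family_carrier_iff)
  define x where "x i = (if nrm (X i) (y i) \<le> B then y i else \<zero>\<^bsub>X i\<^esub>)" for i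
  have x: "bounded_family X x" unfolding bounded_family_def
    by (intro conjI allI exI[of _ "max B 0"]) (auto simp: x_def family_carrier_nth y)
  have "\<forall>\<^sub>F i in U. nrm (X i) (y i \<ominus>\<^bsub>X i\<^esub> x i) = 0"
    using B by eventually_elim (simp add: x_def family_carrier_nth y)
  then have "((\<lambda>i. nrm (X i) (y i \<ominus>\<^bsub>X i\<^esub> x i)) \<longlongrightarrow> 0) U"
    by (rule tendsto_eventually)
  then have "A = ultraclass U X x"
    using ultraclass_eq_iff[OF y(1) bounded_family_carrier[OF x]] y(2) by simp
  with x show thesis by (rule that)
qed

end

lemma nonneg_tendsto_0_iff:
  fixes h :: "'i \<Rightarrow> real"
  assumes "\<And>i. 0 \<le> h i"
  shows "(h \<longlongrightarrow> 0) F \<longleftrightarrow> (\<forall>e>0. \<forall>\<^sub>F i in F. h i \<le> e)"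
proof
  assume *: "(h \<longlongrightarrow> 0) F"
  show "\<forall>e>0. \<forall>\<^sub>F i in F. h i \<le> e"
  proof (intro allI impI)
    fix e :: real assume "0 < e"
    from order_tendstoD(2)[OF * this] show "\<forall>\<^sub>F i in F. h i \<le> e"
      by eventually_elim simp
  qed
next
  assume *: "\<forall>e>0. \<forall>\<^sub>F i in F. h i \<le> e"
  show "(h \<longlongrightarrow> 0) F"
  proof (rule order_tendstoI)
    fix a :: real assume "a < 0"
    then have "a < h i" for i using assms[of i] by simp
    then show "\<forall>\<^sub>F i in F. a < h i" by simp
  next
    fix a :: real assume "0 < a"
    with * have "\<forall>\<^sub>F i in F. h i \<le> a / 2" by (meson half_gt_zero)
    then show "\<forall>\<^sub>F i in F. h i < a" by eventually_elim (use \<open>0 < a\<close> in simp)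
  qed
qed

section \<open>Violated bounds and their witnesses in unit balls\<close>

context homogeneous_between
begin

text \<open>Used in contrapositive form: a violated bound has a witness in the unit ball whose image
  has norm above \<open>C\<close>.\<close>

lemma bound_from_unit_ball:
  assumes C: "\<And>x. x \<in> carrier X \<Longrightarrow> nrm X x \<le> 1 \<Longrightarrow> nrm Y (g x) \<le> C" and x: "x \<in> carrier X"
  shows "nrm Y (g x) \<le> C * nrm X x"
proof (cases "x = \<zero>\<^bsub>X\<^esub>")
  case False
  have pos: "0 < nrm X x" using x False by (simp add: X.nrm_pos_iff)
  have "nrm Y (g ((1 / nrm X x) \<odot>\<^bsub>X\<^esub> x)) \<le> C"
    using x False by (intro C) (auto simp: X.nrm_normalize)
  then show ?thesis using x pos by (simp add: smult Y.nrm_smult field_simps)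
qed simp

text \<open>Dividing by the sum \<open>s\<close> of the two norms puts both vectors into the unit
  ball and, by homogeneity, divides the defect of additivity by \<open>s\<close>.\<close>

lemma quasilinear_bound_from_unit_ball:
  assumes Q: "\<And>x y. x \<in> carrier X \<Longrightarrow> y \<in> carrier X \<Longrightarrow> nrm X x \<le> 1 \<Longrightarrow> nrm X y \<le> 1 \<Longrightarrow>
      nrm Y (g (x \<oplus>\<^bsub>X\<^esub> y) \<ominus>\<^bsub>Y\<^esub> g x \<ominus>\<^bsub>Y\<^esub> g y) \<le> Q"
    and x: "x \<in> carrier X" and y: "y \<in> carrier X"
  shows "nrm Y (g (x \<oplus>\<^bsub>X\<^esub> y) \<ominus>\<^bsub>Y\<^esub> g x \<ominus>\<^bsub>Y\<^esub> g y) \<le> Q * (nrm X x + nrm X y)"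
proof (cases "nrm X x + nrm X y = 0")
  case True
  then have "nrm X x = 0" "nrm X y = 0" using X.nrm_nonneg[OF x] X.nrm_nonneg[OF y] by auto
  then have "x = \<zero>\<^bsub>X\<^esub>" "y = \<zero>\<^bsub>X\<^esub>" using x y by (auto intro: X.nrm_eq_0_imp)
  then show ?thesis by simp
next
  case False
  define s where "s = nrm X x + nrm X y"
  have s: "0 < s" and le: "nrm X x \<le> s" "nrm X y \<le> s"
    using False X.nrm_nonneg[OF x] X.nrm_nonneg[OF y] by (auto simp: s_def)
  let ?x = "(1 / s) \<odot>\<^bsub>X\<^esub> x" and ?y = "(1 / s) \<odot>\<^bsub>X\<^esub> y"
  have "nrm Y (g (?x \<oplus>\<^bsub>X\<^esub> ?y) \<ominus>\<^bsub>Y\<^esub> g ?x \<ominus>\<^bsub>Y\<^esub> g ?y) \<le> Q"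
    using s le x y by (intro Q) (simp_all add: X.nrm_smult)
  also have "g (?x \<oplus>\<^bsub>X\<^esub> ?y) \<ominus>\<^bsub>Y\<^esub> g ?x \<ominus>\<^bsub>Y\<^esub> g ?y =
      (1 / s) \<odot>\<^bsub>Y\<^esub> (g (x \<oplus>\<^bsub>X\<^esub> y) \<ominus>\<^bsub>Y\<^esub> g x \<ominus>\<^bsub>Y\<^esub> g y)"
    using x y by (simp add: X.smult_real_add[symmetric] smult Y.smult_real_diff)
  finally have "nrm Y (g (x \<oplus>\<^bsub>X\<^esub> y) \<ominus>\<^bsub>Y\<^esub> g x \<ominus>\<^bsub>Y\<^esub> g y) \<le> Q * s"
    using s x y by (simp add: Y.nrm_smult field_simps)
  then show ?thesis by (simp add: s_def)
qed

end

context p_normed_family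
begin

lemma select_from_unit_balls:
  assumes "\<forall>\<^sub>F i in U. \<exists>x\<in>carrier (X i). nrm (X i) x \<le> 1 \<and> R i x"
  obtains x where "bounded_family X x" "\<forall>\<^sub>F i in U. R i (x i)"
proof -
  \<comment> \<open>The implication makes the choice total: zero is chosen where no witness exists,
    so the family is bounded by 1 at every index.\<close>
  have "\<exists>x\<in>carrier (X i). nrm (X i) x \<le> 1 \<and> ((\<exists>x\<in>carrier (X i). nrm (X i) x \<le> 1 \<and> R i x) \<longrightarrow> R i x)" for i
    by (cases "\<exists>x\<in>carrier (X i). nrm (X i) x \<le> 1 \<and> R i x") (auto intro: bexI[of _ "\<zero>\<^bsub>X i\<^esub>"])
  then obtain x where x: "\<And>i. x i \<in> carrier (X i)" "\<And>i. nrm (X i) (x i) \<le> 1"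
    "\<And>i. (\<exists>x\<in>carrier (X i). nrm (X i) x \<le> 1 \<and> R i x) \<Longrightarrow> R i (x i)"
    by metis
  have "bounded_family X x" using x(1,2) by (auto simp: bounded_family_def)
  moreover have "\<forall>\<^sub>F i in U. R i (x i)" using assms by eventually_elim (rule x(3))
  ultimately show thesis by (rule that)
qed

end

section \<open>Maps induced between ultraproducts\<close>

locale p_normed_family_pair =
  X: p_normed_family p U X + Y: p_normed_family p U Y
  for p :: real and U :: "'i filter" and X :: "'i \<Rightarrow> 'a normed_module" and Y :: "'i \<Rightarrow> 'b normed_module"
begin

text \<open>Every class has a bounded representative, where the value is prescribed, and off the
  carrier extensionality fixes it. This justifies the definite description in
  \<open>accessible_map\<close>.\<close>

lemma induces_unique:
  assumes "induces U X Y f F" "induces U X Y f G"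
  shows "F = G"
proof (rule PiE_ext)
  show "F \<in> carrier (ultraproduct U X) \<rightarrow>\<^sub>E carrier (ultraproduct U Y)"
    "G \<in> carrier (ultraproduct U X) \<rightarrow>\<^sub>E carrier (ultraproduct U Y)"
    using assms by (simp_all add: induces_def)
  fix A assume "A \<in> carrier (ultraproduct U X)"
  then obtain x where "bounded_family X x" "A = ultraclass U X x"
    by (rule X.bounded_representative)
  then show "F A = G A" using assms by (simp add: induces_def)
qed

lemma accessible_map_eq: "induces U X Y f F \<Longrightarrow> accessible_map U X Y f = F"
  unfolding accessible_map_def by (blast intro: the_equality induces_unique)

end

locale homogeneous_family = p_normed_family_pair p U X Y
  for p :: real and U :: "'i filter" and X :: "'i \<Rightarrow> 'a normed_module" and Y :: "'i \<Rightarrow> 'b normed_module" +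
  fixes f :: "'i \<Rightarrow> 'a \<Rightarrow> 'b"
  assumes homogeneous: "\<And>i. homogeneous_map (X i) (Y i) (f i)"
begin

sublocale f: homogeneous_between p "X i" "Y i" "f i" for i
  by (intro homogeneous_between.intro homogeneous_between_axioms.intro X.p_normed Y.p_normed homogeneous)

definition ev_bounded :: "real \<Rightarrow> bool" where
  "ev_bounded C \<longleftrightarrow> (\<forall>\<^sub>F i in U. \<forall>x\<in>carrier (X i). nrm (Y i) (f i x) \<le> C * nrm (X i) x)"

definition ev_quasilinear :: "real \<Rightarrow> bool" where
  "ev_quasilinear Q \<longleftrightarrow> (\<forall>\<^sub>F i in U. \<forall>x\<in>carrier (X i). \<forall>y\<in>carrier (X i).
     nrm (Y i) (f i (x \<oplus>\<^bsub>X i\<^esub> y) \<ominus>\<^bsub>Y i\<^esub> f i x \<ominus>\<^bsub>Y i\<^esub> f i y) \<le> Q * (nrm (X i) x + nrm (X i) y))"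

lemma ev_map_norm_le_iff:
  "0 \<le> C \<Longrightarrow> (\<forall>\<^sub>F i in U. map_norm (X i) (Y i) (f i) \<le> ennreal C) \<longleftrightarrow> ev_bounded C"
  by (simp add: ev_bounded_def f.map_norm_le_iff)

lemma finite_limit_map_norm_iff:
  "finite_limit U (\<lambda>i. map_norm (X i) (Y i) (f i)) \<longleftrightarrow> (\<exists>C\<ge>0. ev_bounded C)"
proof -
  have "(\<exists>C. \<forall>\<^sub>F i in U. map_norm (X i) (Y i) (f i) \<le> ennreal C) \<longleftrightarrow>
     (\<exists>C\<ge>0. \<forall>\<^sub>F i in U. map_norm (X i) (Y i) (f i) \<le> ennreal C)"
  proof (intro iffI; elim exE)
    fix C assume "\<forall>\<^sub>F i in U. map_norm (X i) (Y i) (f i) \<le> ennreal C"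
    moreover have "ennreal C = ennreal (max C 0)" by (simp add: max_def ennreal_neg)
    ultimately have "0 \<le> max C 0 \<and> (\<forall>\<^sub>F i in U. map_norm (X i) (Y i) (f i) \<le> ennreal (max C 0))"
      by simp
    then show "\<exists>C\<ge>0. \<forall>\<^sub>F i in U. map_norm (X i) (Y i) (f i) \<le> ennreal C" by blast
  qed blast
  then show ?thesis
    using ev_map_norm_le_iff by (auto simp: finite_limit_iff_ev_bounded[OF X.ultra])
qed

lemma map_norm_null_iff:
  "((\<lambda>i. map_norm (X i) (Y i) (f i)) \<longlongrightarrow> 0) U \<longleftrightarrow> (\<forall>e>0. ev_bounded e)"
  by (simp add: ennreal_tendsto_0_iff_le ev_map_norm_le_iff)

lemma quasilinearity_null_iff:
  "((\<lambda>i. quasilinearity (X i) (Y i) (f i)) \<longlongrightarrow> 0) U \<longleftrightarrow> (\<forall>e>0. ev_quasilinear e)"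
proof
  assume *: "((\<lambda>i. quasilinearity (X i) (Y i) (f i)) \<longlongrightarrow> 0) U"
  show "\<forall>e>0. ev_quasilinear e"
  proof (intro allI impI)
    fix e :: real assume "0 < e"
    then have "\<forall>\<^sub>F i in U. quasilinearity (X i) (Y i) (f i) < ennreal e"
      by (intro order_tendstoD(2)[OF *]) simp
    then show "ev_quasilinear e"
      unfolding ev_quasilinear_def
      by eventually_elim (blast intro: quasilinearity_le_imp X.comp.nrm_nonneg)
  qed
next
  assume *: "\<forall>e>0. ev_quasilinear e"
  show "((\<lambda>i. quasilinearity (X i) (Y i) (f i)) \<longlongrightarrow> 0) U"
    unfolding ennreal_tendsto_0_iff_le
  proof (intro allI impI)
    fix e :: real assume e: "0 < e"
    with * have "ev_quasilinear e" by blast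
    then show "\<forall>\<^sub>F i in U. quasilinearity (X i) (Y i) (f i) \<le> ennreal e"
      unfolding ev_quasilinear_def
      by eventually_elim (use e in \<open>simp add: quasilinearity_le\<close>)
  qed
qed

section \<open>From eventual bounds to an induced bounded operator\<close>

lemma image_in_family:
  assumes C: "ev_bounded C" "0 \<le> C" and x: "x \<in> carrier (family_space U X)"
  shows "(\<lambda>i. f i (x i)) \<in> carrier (family_space U Y)"
proof -
  obtain B where B: "\<forall>\<^sub>F i in U. nrm (X i) (x i) \<le> B"
    using x by (auto simp: X.family_carrier_iff)
  have "\<forall>\<^sub>F i in U. nrm (Y i) (f i (x i)) \<le> C * B"
    using B C(1)[unfolded ev_bounded_def]
  proof eventually_elim
    case (elim i)
    have "nrm (Y i) (f i (x i)) \<le> C * nrm (X i) (x i)"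
      using elim(2) X.family_carrier_nth[OF x] by blast
    also have "\<dots> \<le> C * B" using elim(1) C(2) by (rule mult_left_mono)
    finally show ?case .
  qed
  then show ?thesis using x by (auto simp: Y.family_carrier_iff X.family_carrier_nth)
qed

lemma additive_mod_null:
  assumes Q: "\<forall>e>0. ev_quasilinear e"
    and x: "x \<in> carrier (family_space U X)" and y: "y \<in> carrier (family_space U X)"
  shows "((\<lambda>i. nrm (Y i) (f i (x i \<oplus>\<^bsub>X i\<^esub> y i) \<ominus>\<^bsub>Y i\<^esub> f i (x i) \<ominus>\<^bsub>Y i\<^esub> f i (y i))) \<longlongrightarrow> 0) U"
proof (subst nonneg_tendsto_0_iff)
  have c: "x i \<in> carrier (X i)" "y i \<in> carrier (X i)" for i
    using x y by (simp_all add: X.family_carrier_nth)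
  show "0 \<le> nrm (Y i) (f i (x i \<oplus>\<^bsub>X i\<^esub> y i) \<ominus>\<^bsub>Y i\<^esub> f i (x i) \<ominus>\<^bsub>Y i\<^esub> f i (y i))" for i
    by (simp add: c Y.comp.nrm_nonneg)
  obtain B C where BC: "\<forall>\<^sub>F i in U. nrm (X i) (x i) \<le> B" "\<forall>\<^sub>F i in U. nrm (X i) (y i) \<le> C"
    using x y by (auto simp: X.family_carrier_iff)
  show "\<forall>e>0. \<forall>\<^sub>F i in U. nrm (Y i) (f i (x i \<oplus>\<^bsub>X i\<^esub> y i) \<ominus>\<^bsub>Y i\<^esub> f i (x i) \<ominus>\<^bsub>Y i\<^esub> f i (y i)) \<le> e"
  proof (intro allI impI)
    fix e :: real assume e: "0 < e"
    \<comment> \<open>An upper bound for the sum of the two norms; the summand 1 keeps it positive,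
      so that \<open>e / D\<close> is a legitimate constant.\<close>
    define D where "D = \<bar>B\<bar> + \<bar>C\<bar> + 1"
    have D: "0 < D" by (simp add: D_def add_nonneg_pos)
    have "ev_quasilinear (e / D)" using Q e D by simp
    with BC show "\<forall>\<^sub>F i in U. nrm (Y i) (f i (x i \<oplus>\<^bsub>X i\<^esub> y i) \<ominus>\<^bsub>Y i\<^esub> f i (x i) \<ominus>\<^bsub>Y i\<^esub> f i (y i)) \<le> e"
      unfolding ev_quasilinear_def
    proof eventually_elim
      case (elim i)
      have "nrm (Y i) (f i (x i \<oplus>\<^bsub>X i\<^esub> y i) \<ominus>\<^bsub>Y i\<^esub> f i (x i) \<ominus>\<^bsub>Y i\<^esub> f i (y i))
          \<le> e / D * (nrm (X i) (x i) + nrm (X i) (y i))"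
        using elim(3) c by blast
      also have "\<dots> \<le> e / D * D"
        using elim(1,2) e D by (intro mult_left_mono) (auto simp: D_def)
      finally show ?case using D by simp
    qed
  qed
qed

text \<open>With \<open>z\<close> the null difference x - y, f(x) - f(y) is the additivity defect at
  (z, y) plus f(z). The defect is null by quasilinearity and f(z) by boundedness.\<close>

lemma image_cong_mod_null:
  assumes C: "ev_bounded C" "0 \<le> C" and Q: "\<forall>e>0. ev_quasilinear e"
    and x: "x \<in> carrier (family_space U X)" and y: "y \<in> carrier (family_space U X)"
    and eq: "ultraclass U X x = ultraclass U X y"
  shows "ultraclass U Y (\<lambda>i. f i (x i)) = ultraclass U Y (\<lambda>i. f i (y i))"
proof -
  have c [simp]: "x i \<in> carrier (X i)" "y i \<in> carrier (X i)" for i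
    using x y by (simp_all add: X.family_carrier_nth)
  define z where "z i = x i \<ominus>\<^bsub>X i\<^esub> y i" for i
  have zc [simp]: "z i \<in> carrier (X i)" for i by (simp add: z_def)
  have zn: "((\<lambda>i. nrm (X i) (z i)) \<longlongrightarrow> 0) U"
    using eq by (simp add: X.ultraclass_eq_iff[OF x y] z_def)
  then have "z \<in> null_families U X" by (simp only: X.null_families_iff zc simp_thms)
  then have z: "z \<in> carrier (family_space U X)" using X.null.a_subset by (rule subsetD[rotated])
  have "((\<lambda>i. nrm (Y i) (f i (z i))) \<longlongrightarrow> 0) U"
  proof (rule X.dominated_null)
    show "\<forall>\<^sub>F i in U. nrm (Y i) (f i (z i)) \<le> C * nrm (X i) (z i)"
      using C(1) unfolding ev_bounded_def by eventually_elim simp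
    show "((\<lambda>i. C * nrm (X i) (z i)) \<longlongrightarrow> 0) U" using tendsto_mult[OF tendsto_const zn] by simp
  qed (simp add: Y.comp.nrm_nonneg)
  from Y.null_add[OF _ _ additive_mod_null[OF Q z y] this]
  have "((\<lambda>i. nrm (Y i) ((f i (z i \<oplus>\<^bsub>X i\<^esub> y i) \<ominus>\<^bsub>Y i\<^esub> f i (z i) \<ominus>\<^bsub>Y i\<^esub> f i (y i)) \<oplus>\<^bsub>Y i\<^esub> f i (z i))) \<longlongrightarrow> 0) U"
    by simp
  moreover have "(f i (z i \<oplus>\<^bsub>X i\<^esub> y i) \<ominus>\<^bsub>Y i\<^esub> f i (z i) \<ominus>\<^bsub>Y i\<^esub> f i (y i)) \<oplus>\<^bsub>Y i\<^esub> f i (z i)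
      = f i (x i) \<ominus>\<^bsub>Y i\<^esub> f i (y i)" for i
  proof -
    have "z i \<oplus>\<^bsub>X i\<^esub> y i = x i" by (simp add: z_def X.comp.add_diff_self)
    then show ?thesis
      by (simp add: Y.comp.diff_diff_add_cancel)
  qed
  ultimately have "((\<lambda>i. nrm (Y i) (f i (x i) \<ominus>\<^bsub>Y i\<^esub> f i (y i))) \<longlongrightarrow> 0) U" by simp
  then show ?thesis
    by (simp add: Y.ultraclass_eq_iff[OF image_in_family[OF C x] image_in_family[OF C y]])
qed

lemma induced_bounded_operator:
  assumes C: "ev_bounded C" "0 \<le> C" and Q: "\<forall>e>0. ev_quasilinear e"
  obtains F where "induces U X Y f F" "F \<in> bounded_operators (ultraproduct U X) (ultraproduct U Y)"
proof -
  \<comment> \<open>An arbitrary representative; \<open>image_cong_mod_null\<close> makes the value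
    of \<open>F\<close> independent of it. The restriction in \<open>F\<close> provides the
    extensionality that \<open>induces\<close> demands.\<close>
  define r where "r A = (SOME x. x \<in> carrier (family_space U X) \<and> A = ultraclass U X x)" for A
  define F where "F = restrict (\<lambda>A. ultraclass U Y (\<lambda>i. f i (r A i))) (carrier (ultraproduct U X))"
  note img = image_in_family[OF C]
  have r: "r A \<in> carrier (family_space U X)" "ultraclass U X (r A) = A"
    if "A \<in> carrier (ultraproduct U X)" for A
  proof -
    have "\<exists>x. x \<in> carrier (family_space U X) \<and> A = ultraclass U X x"
      using that by (auto simp: X.carrier_ultraproduct)
    from someI_ex[OF this]
    show "r A \<in> carrier (family_space U X)" "ultraclass U X (r A) = A" by (simp_all add: r_def)
  qed
  have F: "F (ultraclass U X x) = ultraclass U Y (\<lambda>i. f i (x i))" if x: "x \<in> carrier (family_space U X)" for x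
  proof -
    have A: "ultraclass U X x \<in> carrier (ultraproduct U X)" using x by (simp add: X.carrier_ultraproduct)
    then show ?thesis
      using image_cong_mod_null[OF C Q r(1)[OF A] x r(2)[OF A]] by (simp add: F_def)
  qed
  have closed: "F A \<in> carrier (ultraproduct U Y)" if A: "A \<in> carrier (ultraproduct U X)" for A
    using img[OF r(1)[OF A]] A by (simp add: F_def Y.carrier_ultraproduct)
  have "F \<in> carrier (ultraproduct U X) \<rightarrow>\<^sub>E carrier (ultraproduct U Y)"
  proof (rule PiE_I)
    fix A assume "A \<notin> carrier (ultraproduct U X)"
    then show "F A = undefined" by (simp add: F_def)
  qed (rule closed)
  then have "induces U X Y f F"
    using F img X.bounded_family_carrier by (auto simp: induces_def)
  moreover have "F \<in> bounded_operators (ultraproduct U X) (ultraproduct U Y)"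
    unfolding bounded_operators_def
  proof (intro CollectI conjI ballI allI Pi_I closed)
    fix A B assume "A \<in> carrier (ultraproduct U X)" "B \<in> carrier (ultraproduct U X)"
    then obtain x y where x: "x \<in> carrier (family_space U X)" "A = ultraclass U X x"
      and y: "y \<in> carrier (family_space U X)" "B = ultraclass U X y"
      by (auto simp: X.carrier_ultraproduct)
    have c [simp]: "x i \<in> carrier (X i)" "y i \<in> carrier (X i)" for i
      using x y by (simp_all add: X.family_carrier_nth)
    have "((\<lambda>i. nrm (Y i) (f i (x i \<oplus>\<^bsub>X i\<^esub> y i) \<ominus>\<^bsub>Y i\<^esub> (f i (x i) \<oplus>\<^bsub>Y i\<^esub> f i (y i)))) \<longlongrightarrow> 0) U"
      using additive_mod_null[OF Q x(1) y(1)] by (simp add: Y.comp.diff_diff_add)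
    then have "ultraclass U Y (\<lambda>i. f i (x i \<oplus>\<^bsub>X i\<^esub> y i)) = ultraclass U Y (\<lambda>i. f i (x i) \<oplus>\<^bsub>Y i\<^esub> f i (y i))"
      using x(1) y(1) by (simp add: Y.ultraclass_eq_iff img X.family_add_closed Y.family_add_closed)
    then show "F (A \<oplus>\<^bsub>ultraproduct U X\<^esub> B) = F A \<oplus>\<^bsub>ultraproduct U Y\<^esub> F B"
      using x y by (simp add: X.ultraproduct_add Y.ultraproduct_add F img X.family_add_closed)
  next
    fix t A assume "A \<in> carrier (ultraproduct U X)"
    then obtain x where x: "x \<in> carrier (family_space U X)" "A = ultraclass U X x"
      by (auto simp: X.carrier_ultraproduct)
    then show "F (t \<odot>\<^bsub>ultraproduct U X\<^esub> A) = t \<odot>\<^bsub>ultraproduct U Y\<^esub> F A"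
      by (simp add: X.ultraproduct_smult Y.ultraproduct_smult F img X.family_smult_closed
          f.smult X.family_carrier_nth)
  next
    have "map_norm (ultraproduct U X) (ultraproduct U Y) F \<le> ennreal C"
      unfolding map_norm_def
    proof (rule SUP_least, elim CollectE conjE)
      fix A assume "A \<in> carrier (ultraproduct U X)" and one: "nrm (ultraproduct U X) A = 1"
      then obtain x where x: "x \<in> carrier (family_space U X)" "A = ultraclass U X x"
        by (auto simp: X.carrier_ultraproduct)
      obtain a where a: "((\<lambda>i. nrm (X i) (x i)) \<longlongrightarrow> a) U" by (rule X.family_norm_tendsto[OF x(1)])
      obtain b where b: "((\<lambda>i. nrm (Y i) (f i (x i))) \<longlongrightarrow> b) U" by (rule Y.family_norm_tendsto[OF img[OF x(1)]])
      \<comment> \<open>A representative of a unit class need not consist of unit vectors; only its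
        norms tend to 1. The bound \<open>C\<close> therefore appears after passing to the
        limit.\<close>
      have "a = 1" using X.ultraproduct_nrm[OF x(1) a] one x(2) by simp
      then have "((\<lambda>i. C * nrm (X i) (x i)) \<longlongrightarrow> C) U"
        using tendsto_mult[OF tendsto_const[of C] a] by simp
      then have "b \<le> C"
      proof (rule tendsto_le[OF X.nontrivial _ b])
        show "\<forall>\<^sub>F i in U. nrm (Y i) (f i (x i)) \<le> C * nrm (X i) (x i)"
          using C(1) unfolding ev_bounded_def
          by eventually_elim (simp add: X.family_carrier_nth[OF x(1)])
      qed
      moreover have "nrm (ultraproduct U Y) (F A) = b"
        using Y.ultraproduct_nrm[OF img[OF x(1)] b] by (simp add: F x)
      ultimately show "ennreal (nrm (ultraproduct U Y) (F A)) \<le> ennreal C"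
        by (simp add: ennreal_leI)
    qed
    then show "map_norm (ultraproduct U X) (ultraproduct U Y) F < \<infinity>"
      by (simp add: le_less_trans)
  qed
  ultimately show thesis by (rule that)
qed

section \<open>From an induced map back to eventual bounds\<close>

lemma induced_imp_ev_bounded:
  assumes ci: "countably_incomplete U" and F: "induces U X Y f F"
  shows "\<exists>C\<ge>0. ev_bounded C"
proof (rule ccontr)
  assume contr: "\<not> (\<exists>C\<ge>0. ev_bounded C)"
  have "\<forall>\<^sub>F i in U. \<exists>x\<in>carrier (X i). nrm (X i) x \<le> 1 \<and> real n < nrm (Y i) (f i x)" for n
  proof -
    have "\<not> ev_bounded (real n)" using contr by auto
    then have "\<forall>\<^sub>F i in U. \<not> (\<forall>x\<in>carrier (X i). nrm (Y i) (f i x) \<le> real n * nrm (X i) x)"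
      unfolding ev_bounded_def by (rule X.ev_not)
    then show ?thesis
      by eventually_elim (meson f.bound_from_unit_ball not_le)
  qed
  then obtain N :: "'i \<Rightarrow> nat" where N: "\<And>k. \<forall>\<^sub>F i in U. k \<le> N i"
    "\<forall>\<^sub>F i in U. \<exists>x\<in>carrier (X i). nrm (X i) x \<le> 1 \<and> real (N i) < nrm (Y i) (f i x)"
    using countably_incomplete_diagonal[OF X.ultra ci,
      of "\<lambda>n i. \<exists>x\<in>carrier (X i). nrm (X i) x \<le> 1 \<and> real n < nrm (Y i) (f i x)"] by blast
  obtain x where x: "bounded_family X x" "\<forall>\<^sub>F i in U. real (N i) < nrm (Y i) (f i (x i))"
    using X.select_from_unit_balls[OF N(2)] .
  \<comment> \<open>The contradiction is with this part of \<open>induces\<close>: the image of a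
    bounded family must have eventually bounded norms.\<close>
  have "(\<lambda>i. f i (x i)) \<in> carrier (family_space U Y)" using F x(1) by (simp add: induces_def)
  then obtain B where B: "\<forall>\<^sub>F i in U. nrm (Y i) (f i (x i)) \<le> B" by (auto simp: Y.family_carrier_iff)
  obtain k :: nat where k: "B < real k" using reals_Archimedean2 by blast
  have "\<forall>\<^sub>F i in U. False" using x(2) B N(1)[of k] by eventually_elim (use k in linarith)
  then show False by (simp add: trivial_limit_def[symmetric])
qed

lemma induced_additive_imp_ev_quasilinear:
  assumes F: "induces U X Y f F"
    and add: "\<And>A B. A \<in> carrier (ultraproduct U X) \<Longrightarrow> B \<in> carrier (ultraproduct U X) \<Longrightarrow>
       F (A \<oplus>\<^bsub>ultraproduct U X\<^esub> B) = F A \<oplus>\<^bsub>ultraproduct U Y\<^esub> F B"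
    and e: "0 < e"
  shows "ev_quasilinear e"
proof (rule ccontr)
  define R where "R i x y \<longleftrightarrow> e < nrm (Y i) (f i (x \<oplus>\<^bsub>X i\<^esub> y) \<ominus>\<^bsub>Y i\<^esub> f i x \<ominus>\<^bsub>Y i\<^esub> f i y)" for i x y
  assume "\<not> ev_quasilinear e"
  then have "\<forall>\<^sub>F i in U. \<not> (\<forall>x\<in>carrier (X i). \<forall>y\<in>carrier (X i).
      nrm (Y i) (f i (x \<oplus>\<^bsub>X i\<^esub> y) \<ominus>\<^bsub>Y i\<^esub> f i x \<ominus>\<^bsub>Y i\<^esub> f i y) \<le> e * (nrm (X i) x + nrm (X i) y))"
    unfolding ev_quasilinear_def by (rule X.ev_not)
  \<comment> \<open>The second witness stays under its quantifier so that the selection lemma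
    applies twice, to \<open>x\<close> and then to \<open>y\<close> for that
    \<open>x\<close>.\<close>
  then have "\<forall>\<^sub>F i in U. \<exists>x\<in>carrier (X i). nrm (X i) x \<le> 1 \<and>
      (\<exists>y\<in>carrier (X i). nrm (X i) y \<le> 1 \<and> R i x y)"
    by eventually_elim (unfold R_def, meson f.quasilinear_bound_from_unit_ball not_le)
  then obtain x where x: "bounded_family X x"
    and ev: "\<forall>\<^sub>F i in U. \<exists>y\<in>carrier (X i). nrm (X i) y \<le> 1 \<and> R i (x i) y"
    by (rule X.select_from_unit_balls)
  from ev obtain y where y: "bounded_family X y" and R: "\<forall>\<^sub>F i in U. R i (x i) (y i)"
    by (rule X.select_from_unit_balls)
  let ?s = "\<lambda>i. x i \<oplus>\<^bsub>X i\<^esub> y i"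
  note xc = X.bounded_family_carrier[OF x] and yc = X.bounded_family_carrier[OF y]
  have c [simp]: "x i \<in> carrier (X i)" "y i \<in> carrier (X i)" for i
    using xc yc by (simp_all add: X.family_carrier_nth)
  \<comment> \<open>\<open>induces\<close> prescribes values only at bounded families, so the sum
    must be bounded at every index.\<close>
  have s: "bounded_family X ?s"
  proof -
    obtain B C where BC: "\<And>i. nrm (X i) (x i) \<le> B" "\<And>i. nrm (X i) (y i) \<le> C"
      using x y by (auto simp: bounded_family_def)
    have "nrm (X i) (?s i) \<le> 2 powr (1 / p) * (B + C)" for i
    proof -
      have "nrm (X i) (?s i) \<le> 2 powr (1 / p) * (nrm (X i) (x i) + nrm (X i) (y i))"
        by (simp add: X.comp.nrm_add_quasi)
      also have "\<dots> \<le> 2 powr (1 / p) * (B + C)"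
        using BC by (intro mult_left_mono add_mono) auto
      finally show ?thesis .
    qed
    then show ?thesis by (auto simp: bounded_family_def)
  qed
  have ind: "(\<lambda>i. f i (z i)) \<in> carrier (family_space U Y)"
    "F (ultraclass U X z) = ultraclass U Y (\<lambda>i. f i (z i))" if "bounded_family X z" for z
    using F that by (auto simp: induces_def)
  have "ultraclass U Y (\<lambda>i. f i (?s i)) = F (ultraclass U X x \<oplus>\<^bsub>ultraproduct U X\<^esub> ultraclass U X y)"
    using ind(2)[OF s] by (simp add: X.ultraproduct_add[OF xc yc])
  also have "\<dots> = F (ultraclass U X x) \<oplus>\<^bsub>ultraproduct U Y\<^esub> F (ultraclass U X y)"
    using xc yc by (intro add) (simp_all add: X.carrier_ultraproduct)
  also have "\<dots> = ultraclass U Y (\<lambda>i. f i (x i) \<oplus>\<^bsub>Y i\<^esub> f i (y i))"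
    by (simp add: ind x y Y.ultraproduct_add)
  finally have "((\<lambda>i. nrm (Y i) (f i (?s i) \<ominus>\<^bsub>Y i\<^esub> (f i (x i) \<oplus>\<^bsub>Y i\<^esub> f i (y i)))) \<longlongrightarrow> 0) U"
    by (simp add: Y.ultraclass_eq_iff ind s x y Y.family_add_closed)
  from order_tendstoD(2)[OF this e]
  have "\<forall>\<^sub>F i in U. nrm (Y i) (f i (?s i) \<ominus>\<^bsub>Y i\<^esub> (f i (x i) \<oplus>\<^bsub>Y i\<^esub> f i (y i))) < e" .
  with R have "\<forall>\<^sub>F i in U. False"
    by eventually_elim (simp add: R_def Y.comp.diff_diff_add)
  then show False by (simp add: trivial_limit_def[symmetric])
qed

end

section \<open>Comparison with ultraproducts of operators\<close>

lemma bounded_operators_imp_homogeneous: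
  "u \<in> bounded_operators X Y \<Longrightarrow> homogeneous_map X Y u"
  by (auto simp: bounded_operators_def homogeneous_map_def)

context homogeneous_between
begin

lemma homogeneous_map_diff:
  assumes "homogeneous_map X Y h"
  shows "homogeneous_map X Y (\<lambda>x. g x \<ominus>\<^bsub>Y\<^esub> h x)"
  using assms by (auto simp: homogeneous_map_def smult Y.smult_real_diff Pi_iff)

end

lemma (in p_normed_family_pair) zero_in_bounded_operators: "(\<lambda>x. \<zero>\<^bsub>Y i\<^esub>) \<in> bounded_operators (X i) (Y i)"
proof -
  have "map_norm (X i) (Y i) (\<lambda>x. \<zero>\<^bsub>Y i\<^esub>) \<le> 0"
    unfolding map_norm_def by (rule SUP_least) simp
  then show ?thesis by (simp add: bounded_operators_def)
qed

context homogeneous_family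
begin

text \<open>\<open>u\<close> is assumed to satisfy no bound: its image family lies in the class of
  the image under \<open>f\<close>, and classes consist of eventually bounded families.\<close>

lemma induces_close:
  assumes F: "induces U X Y f F" and u: "\<And>i x. x \<in> carrier (X i) \<Longrightarrow> u i x \<in> carrier (Y i)"
    and close: "\<And>x. bounded_family X x \<Longrightarrow> ((\<lambda>i. nrm (Y i) (f i (x i) \<ominus>\<^bsub>Y i\<^esub> u i (x i))) \<longlongrightarrow> 0) U"
  shows "induces U X Y u F"
  unfolding induces_def
proof (intro conjI allI impI)
  show "F \<in> carrier (ultraproduct U X) \<rightarrow>\<^sub>E carrier (ultraproduct U Y)" using F by (simp add: induces_def)
  fix x assume x: "bounded_family X x"
  note xc = X.family_carrier_nth[OF X.bounded_family_carrier[OF x]]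
  have f: "(\<lambda>i. f i (x i)) \<in> carrier (family_space U Y)"
    "F (ultraclass U X x) = ultraclass U Y (\<lambda>i. f i (x i))"
    using F x by (auto simp: induces_def)
  have "((\<lambda>i. nrm (Y i) (u i (x i) \<ominus>\<^bsub>Y i\<^esub> f i (x i))) \<longlongrightarrow> 0) U"
    using close[OF x] xc u by (simp add: Y.comp.nrm_diff_commute[of "f _ (x _)" _ "u _ (x _)"])
  then have "(\<lambda>i. u i (x i)) \<in> ultraclass U Y (\<lambda>i. f i (x i))"
    using f(1) xc u by (simp add: Y.in_ultraclass_iff)
  then show uc: "(\<lambda>i. u i (x i)) \<in> carrier (family_space U Y)"
    using Y.ultraclass_subset[OF f(1)] by blast
  show "F (ultraclass U X x) = ultraclass U Y (\<lambda>i. u i (x i))"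
    using close[OF x] f by (simp add: Y.ultraclass_eq_iff uc)
qed

text \<open>Lets the bounds and witness lemmas be applied to the differences f_i - u_i.\<close>

lemma diff_homogeneous_family:
  assumes "\<And>i. homogeneous_map (X i) (Y i) (u i)"
  shows "homogeneous_family p U X Y (\<lambda>i x. f i x \<ominus>\<^bsub>Y i\<^esub> u i x)"
  by unfold_locales (rule f.homogeneous_map_diff[OF assms])

text \<open>If the norms did not tend to 0, some fixed \<open>e\<close> would be exceeded in the
  unit balls on a large set; at the family of witnesses the two image classes would differ.\<close>

lemma same_induced_imp_diff_null:
  assumes F: "induces U X Y f F" "induces U X Y u F" and u: "\<And>i. homogeneous_map (X i) (Y i) (u i)"
  shows "((\<lambda>i. map_norm (X i) (Y i) (\<lambda>x. f i x \<ominus>\<^bsub>Y i\<^esub> u i x)) \<longlongrightarrow> 0) U"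
proof -
  interpret d: homogeneous_family p U X Y "\<lambda>i x. f i x \<ominus>\<^bsub>Y i\<^esub> u i x"
    by (rule diff_homogeneous_family[OF u])
  have "d.ev_bounded e" if e: "0 < e" for e
  proof (rule ccontr)
    assume "\<not> d.ev_bounded e"
    then have "\<forall>\<^sub>F i in U. \<not> (\<forall>x\<in>carrier (X i). nrm (Y i) (f i x \<ominus>\<^bsub>Y i\<^esub> u i x) \<le> e * nrm (X i) x)"
      unfolding d.ev_bounded_def by (rule X.ev_not)
    then have "\<forall>\<^sub>F i in U. \<exists>x\<in>carrier (X i). nrm (X i) x \<le> 1 \<and> e < nrm (Y i) (f i x \<ominus>\<^bsub>Y i\<^esub> u i x)"
      by eventually_elim (meson d.f.bound_from_unit_ball not_le)
    then obtain x where x: "bounded_family X x"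
      and gt: "\<forall>\<^sub>F i in U. e < nrm (Y i) (f i (x i) \<ominus>\<^bsub>Y i\<^esub> u i (x i))"
      by (rule X.select_from_unit_balls)
    have "((\<lambda>i. nrm (Y i) (f i (x i) \<ominus>\<^bsub>Y i\<^esub> u i (x i))) \<longlongrightarrow> 0) U"
      using F x by (auto simp: induces_def Y.ultraclass_eq_iff[symmetric])
    from order_tendstoD(2)[OF this e] gt have "\<forall>\<^sub>F i in U. False"
      by eventually_elim simp
    then show False by (simp add: trivial_limit_def[symmetric])
  qed
  then show ?thesis by (simp add: d.map_norm_null_iff)
qed

text \<open>The given operators are controlled only on a large set, but an ultraproduct of operators
  needs one bound for all indices. Replacing the operators with norm above \<open>K\<close> by zero
  repairs this without changing the induced map.\<close>

lemma diff_null_imp_ultraproduct_of_operators: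
  assumes C: "ev_bounded C" "0 \<le> C" and F: "induces U X Y f F"
    and u: "\<And>i. u i \<in> bounded_operators (X i) (Y i)"
    and null: "((\<lambda>i. map_norm (X i) (Y i) (\<lambda>x. f i x \<ominus>\<^bsub>Y i\<^esub> u i x)) \<longlongrightarrow> 0) U"
  shows "ultraproduct_of_operators U X Y F"
proof -
  interpret d: homogeneous_family p U X Y "\<lambda>i x. f i x \<ominus>\<^bsub>Y i\<^esub> u i x"
    by (rule diff_homogeneous_family) (rule bounded_operators_imp_homogeneous[OF u])
  have d: "d.ev_bounded e" if "0 < e" for e using null that by (simp add: d.map_norm_null_iff)
  \<comment> \<open>From u = (u - f) + f by the quasinorm inequality: eventually \<open>f\<close>
    has bound \<open>C\<close> and the difference has bound 1.\<close>
  define K where "K = 2 powr (1 / p) * (C + 1)"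
  have K: "0 \<le> K" using C(2) by (simp add: K_def)
  have uc: "u i x \<in> carrier (Y i)" if "x \<in> carrier (X i)" for i x
    using u[of i] that by (auto simp: bounded_operators_def)
  have hom: "homogeneous_between p (X i) (Y i) (u i)" for i
    by (intro homogeneous_between.intro homogeneous_between_axioms.intro X.p_normed Y.p_normed
        bounded_operators_imp_homogeneous u)
  define v where "v i = (if map_norm (X i) (Y i) (u i) \<le> ennreal K then u i else (\<lambda>x. \<zero>\<^bsub>Y i\<^esub>))" for i
  have "\<forall>\<^sub>F i in U. map_norm (X i) (Y i) (u i) \<le> ennreal K"
    using C(1) d[OF zero_less_one] unfolding ev_bounded_def d.ev_bounded_def
  proof eventually_elim
    case (elim i)
    show ?case
      unfolding homogeneous_between.map_norm_le_iff[OF hom K]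
    proof
      fix x assume x: "x \<in> carrier (X i)"
      have "u i x = (u i x \<ominus>\<^bsub>Y i\<^esub> f i x) \<oplus>\<^bsub>Y i\<^esub> f i x"
        using x uc by (simp add: Y.comp.add_diff_self)
      then have "nrm (Y i) (u i x) \<le> 2 powr (1 / p) * (nrm (Y i) (u i x \<ominus>\<^bsub>Y i\<^esub> f i x) + nrm (Y i) (f i x))"
        using Y.comp.nrm_add_quasi[of "u i x \<ominus>\<^bsub>Y i\<^esub> f i x" i "f i x"] x uc by simp
      also have "\<dots> \<le> 2 powr (1 / p) * (1 * nrm (X i) x + C * nrm (X i) x)"
        using elim x Y.comp.nrm_diff_commute[of "f i x" i "u i x"] uc
        by (intro mult_left_mono add_mono) simp_all
      finally show "nrm (Y i) (u i x) \<le> K * nrm (X i) x" by (simp add: K_def algebra_simps)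
    qed
  qed
  then have uv: "\<forall>\<^sub>F i in U. v i = u i" by eventually_elim (simp add: v_def)
  have vc: "v i x \<in> carrier (Y i)" if "x \<in> carrier (X i)" for i x
    using that uc by (simp add: v_def)
  have v: "v i \<in> bounded_operators (X i) (Y i)" for i
    by (simp add: v_def u zero_in_bounded_operators)
  have vK: "map_norm (X i) (Y i) (v i) \<le> ennreal K" for i
  proof -
    have "map_norm (X i) (Y i) (\<lambda>x. \<zero>\<^bsub>Y i\<^esub>) \<le> ennreal K"
      unfolding map_norm_def by (rule SUP_least) simp
    then show ?thesis by (simp add: v_def)
  qed
  have "induces U X Y v F"
  proof (rule induces_close[OF F vc])
    fix x assume x: "bounded_family X x"
    note xc = X.family_carrier_nth[OF X.bounded_family_carrier[OF x]]
    obtain B where B: "\<And>i. nrm (X i) (x i) \<le> B" using x by (auto simp: bounded_family_def)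
    show "((\<lambda>i. nrm (Y i) (f i (x i) \<ominus>\<^bsub>Y i\<^esub> v i (x i))) \<longlongrightarrow> 0) U"
    proof (subst nonneg_tendsto_0_iff; (intro allI impI)?)
      show "0 \<le> nrm (Y i) (f i (x i) \<ominus>\<^bsub>Y i\<^esub> v i (x i))" for i
        by (simp add: xc vc Y.comp.nrm_nonneg)
      fix e :: real assume e: "0 < e"
      define D where "D = \<bar>B\<bar> + 1"
      have D: "0 < D" by (simp add: D_def add_nonneg_pos)
      have "d.ev_bounded (e / D)" using e D by (intro d) simp
      with uv show "\<forall>\<^sub>F i in U. nrm (Y i) (f i (x i) \<ominus>\<^bsub>Y i\<^esub> v i (x i)) \<le> e"
        unfolding d.ev_bounded_def
      proof eventually_elim
        case (elim i)
        have "nrm (Y i) (f i (x i) \<ominus>\<^bsub>Y i\<^esub> v i (x i)) \<le> e / D * nrm (X i) (x i)"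
          using elim xc by simp
        also have "\<dots> \<le> e / D * D"
          using B[of i] e D by (intro mult_left_mono) (auto simp: D_def)
        finally show ?case using D by simp
      qed
    qed
  qed
  then show ?thesis
    unfolding ultraproduct_of_operators_def admissible_def
    using v vK accessible_map_eq by metis
qed

end

theorem theorem4:
  fixes p :: real
    and U :: "'i filter"
    and X :: "'i \<Rightarrow> 'a normed_module"
    and Y :: "'i \<Rightarrow> 'b normed_module"
    and f :: "'i \<Rightarrow> 'a \<Rightarrow> 'b"
  assumes "0 < p" and "p \<le> 1"
    and "ultrafilter U" and "countably_incomplete U"
    and "\<And>i. p_banach_space p (X i)" and "\<And>i. p_banach_space p (Y i)"
    and "\<And>i. homogeneous_map (X i) (Y i) (f i)"
  shows "((admissible U X Y f \<and>
             accessible_map U X Y f \<in> bounded_operators (ultraproduct U X) (ultraproduct U Y))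
           \<longleftrightarrow>
           (finite_limit U (\<lambda>i. map_norm (X i) (Y i) (f i)) \<and>
             ((\<lambda>i. quasilinearity (X i) (Y i) (f i)) \<longlongrightarrow> 0) U))
       \<and> (admissible U X Y f \<and>
             accessible_map U X Y f \<in> bounded_operators (ultraproduct U X) (ultraproduct U Y)
           \<longrightarrow>
           (ultraproduct_of_operators U X Y (accessible_map U X Y f)
            \<longleftrightarrow>
            (\<exists>u. (\<forall>i. u i \<in> bounded_operators (X i) (Y i)) \<and>
                 ((\<lambda>i. map_norm (X i) (Y i) (\<lambda>x. f i x \<ominus>\<^bsub>Y i\<^esub> u i x)) \<longlongrightarrow> 0) U)))"
    (is "(?a \<longleftrightarrow> ?b) \<and> (?a \<longrightarrow> (?op \<longleftrightarrow> ?close))")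
proof -
  interpret homogeneous_family p U X Y f
    by (intro homogeneous_family.intro p_normed_family_pair.intro p_normed_family.intro
        homogeneous_family_axioms.intro p_banach_space.axioms(1) assms)
  have b: "?b \<longleftrightarrow> (\<exists>C\<ge>0. ev_bounded C) \<and> (\<forall>e>0. ev_quasilinear e)"
    by (simp only: finite_limit_map_norm_iff quasilinearity_null_iff)
  have ab: ?b if a: ?a
  proof -
    obtain F where F: "induces U X Y f F" using a by (auto simp: admissible_def)
    have "F \<in> bounded_operators (ultraproduct U X) (ultraproduct U Y)"
      using a accessible_map_eq[OF F] by simp
    then have "F (A \<oplus>\<^bsub>ultraproduct U X\<^esub> B) = F A \<oplus>\<^bsub>ultraproduct U Y\<^esub> F B"
      if "A \<in> carrier (ultraproduct U X)" "B \<in> carrier (ultraproduct U X)" for A B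
      using that by (simp add: bounded_operators_def)
    then show ?b
      unfolding b using induced_imp_ev_bounded[OF assms(4) F]
        induced_additive_imp_ev_quasilinear[OF F] by blast
  qed
  moreover have ?a if ?b
  proof -
    obtain C where C: "ev_bounded C" "0 \<le> C" "\<forall>e>0. ev_quasilinear e" using \<open>?b\<close> b by blast
    obtain F where "induces U X Y f F" "F \<in> bounded_operators (ultraproduct U X) (ultraproduct U Y)"
      using induced_bounded_operator[OF C] .
    then show ?a using accessible_map_eq by (auto simp: admissible_def)
  qed
  moreover have "?op \<longleftrightarrow> ?close" if a: ?a
  proof -
    obtain F where F: "induces U X Y f F" using a by (auto simp: admissible_def)
    note acc = accessible_map_eq[OF F]
    \<comment> \<open>The truncation of operators needs a bound for \<open>f\<close>, which the
      implication from (a) to (b) supplies.\<close>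
    obtain C where C: "ev_bounded C" "0 \<le> C" using ab[OF a] b by blast
    show ?thesis
    proof
      assume ?op
      then obtain u where u: "\<And>i. u i \<in> bounded_operators (X i) (Y i)" "admissible U X Y u"
        "F = accessible_map U X Y u"
        unfolding ultraproduct_of_operators_def acc by blast
      \<comment> \<open>Admissibility of \<open>u\<close> gives some induced map, and uniqueness
        identifies it with \<open>accessible_map U X Y u\<close>, that is, with
        \<open>F\<close>.\<close>
      then have "induces U X Y u F" using accessible_map_eq by (auto simp: admissible_def)
      then show ?close
        using same_induced_imp_diff_null[OF F _ bounded_operators_imp_homogeneous[OF u(1)]] u(1) by blast
    next
      assume ?close
      then show ?op
        unfolding acc using diff_null_imp_ultraproduct_of_operators[OF C F] by blast
    qed
  qed
  ultimately show ?thesis by blast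
qed

end
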